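(* Let $(S,m)$ be a $\sigma$-finite positive measure space, $1\le p<\infty$, and $q$ the conjugate exponent ($1/p+1/q=1$ if $p>1$, $q=\infty$ if $p=1$). Let $G=\{g\in L^q(S,m):\|g\|_q\le1\}$. Let $A$ be a compact Hausdorff space and $\{f_a\}_{a\in A}\subset L^p(S,m)$ such that $a\mapsto f_a$ is continuous from $A$ into $L^p(S,m)$ (norm topology). Let $H$ be a linear subspace of $L^p(S,m)$ of finite dimension $n\ge1$. Then $f^*\in H$ satisfies $\max_{a\in A}\|f_a-f^*\|_p\le\max_{a\in A}\|f_a-f\|_p$ for all $f\in H$ if and only if there exist an integer $k$ with $1\le k\le n+1$, elements $a_1,\dots,a_k\in A$, functions $g_1,\dots,g_k\in G$, and positive numbers $\lambda_1,\dots,\lambda_k$ with $\sum_{i=1}^k\lambda_i=1$ such that (i) $\int_S\big(\sum_{i=1}^k\lambda_i g_i\big)h\,dm=0$ for all $h\in H$; and (ii) $\int_S g_i(f_{a_i}-f^* )\,dm=\|f_{a_i}-f^*\|_p=\max_{a\in A}\|f_a-f^*\|_p$ for all $1\le i\le k$.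
   Context: $L^p(S,m)$ denotes real-valued measurable functions with $|f|^p$ integrable, $\|f\|_p=(\int_S|f|^p\,dm)^{1/p}$, and $\|g\|_\infty=\operatorname{ess\,sup}|g|$. *)

theory Defs
  imports "HOL-Analysis.Analysis" "HOL-Probability.Essential_Supremum" "HOL-Library.Function_Algebras"
begin

definition fscale :: "real \<Rightarrow> ('b \<Rightarrow> real) \<Rightarrow> ('b \<Rightarrow> real)" where
  "fscale r f = (\<lambda>x. r * f x)"

lemma vector_space_fscale: "vector_space fscale"
  by unfold_locales (auto simp: fscale_def fun_eq_iff algebra_simps)

definition conj_exp :: "real \<Rightarrow> ereal" where
  "conj_exp p = (if p = 1 then \<infinity> else ereal (p / (p - 1)))"

text \<open>L^q(S,m) for 1 \<le> q \<le> \<infinity> (as a set of real functions, not a.e.-classes).\<close>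
definition Lspace :: "'b measure \<Rightarrow> ereal \<Rightarrow> ('b \<Rightarrow> real) set" where
  "Lspace M q = (if q = \<infinity>
     then {g \<in> borel_measurable M. esssup M (\<lambda>x. ereal \<bar>g x\<bar>) < \<infinity>}
     else {g \<in> borel_measurable M. integrable M (\<lambda>x. \<bar>g x\<bar> powr real_of_ereal q)})"

definition Lnorm :: "'b measure \<Rightarrow> ereal \<Rightarrow> ('b \<Rightarrow> real) \<Rightarrow> real" where
  "Lnorm M q g = (if q = \<infinity>
     then real_of_ereal (esssup M (\<lambda>x. ereal \<bar>g x\<bar>))
     else (\<integral>x. \<bar>g x\<bar> powr real_of_ereal q \<partial>M) powr (1 / real_of_ereal q))"

definition Lball :: "'b measure \<Rightarrow> ereal \<Rightarrow> ('b \<Rightarrow> real) set" where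
  "Lball M q = {g \<in> Lspace M q. Lnorm M q g \<le> 1}"

end

theory Submission
  imports Defs
begin

text \<open>
  A certificate gives optimality by integrating against it and applying Hoelder's inequality.

  Conversely, let \<open>f\<^sup>*\<close> be optimal with error \<open>E > 0\<close>, let \<open>h\<^sub>0, \<dots>, h\<^sub>n\<^sub>-\<^sub>1\<close> span \<open>H\<close>, and put
  \<open>r\<^sub>a = f\<^sub>a - f\<^sup>*\<close>. Instead of weak-* compactness of the unit ball of \<open>L\<^sup>q\<close>, use the functionals of norm
  at most one on the finite-dimensional spaces \<open>span {r\<^sub>a, h\<^sub>0, \<dots>, h\<^sub>n\<^sub>-\<^sub>1}\<close>, given by their values on these
  generators: together with \<open>a\<close> they form a compact set. Let \<open>K\<close> be the compact set of the vectors
  \<open>(y h\<^sub>0, \<dots>, y h\<^sub>n\<^sub>-\<^sub>1)\<close> with \<open>y r\<^sub>a = E\<close>. If zero were not a convex combination of \<open>n + 1\<close> points of \<open>K\<close>,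
  a hyperplane would separate it strictly from \<open>K\<close>, and a small step in the normal direction would decrease the
  error, contradicting optimality. It remains to represent a functional attaining its norm at \<open>r\<^sub>a\<close> by some
  \<open>g\<close> in the unit ball of \<open>L\<^sup>q\<close>. For \<open>p > 1\<close> differentiability of the norm forces
  \<open>g = sgn r\<^sub>a \<bar>r\<^sub>a\<bar>\<^sup>p\<^sup>-\<^sup>1 / E\<^sup>p\<^sup>-\<^sup>1\<close>. For \<open>p = 1\<close> a density is found by minimising a smooth
  perturbation of the norm minus the functional, with an induction on the dimension for the directions in
  which the functional attains its norm.
\<close>

section \<open>Norms and duality in \<open>L\<^sup>p\<close>\<close>

lemma Lball_infinity_iff:
  "g \<in> Lball M \<infinity> \<longleftrightarrow> g \<in> borel_measurable M \<and> (AE x in M. \<bar>g x\<bar> \<le> 1)"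
proof -
  let ?e = "esssup M (\<lambda>x. ereal \<bar>g x\<bar>)"
  have "AE x in M. \<bar>g x\<bar> \<le> 1" if "?e < \<infinity>" "real_of_ereal ?e \<le> 1"
  proof -
    have "AE x in M. ereal \<bar>g x\<bar> \<le> ?e" by (rule esssup_AE)
    then show ?thesis
    proof eventually_elim
      case (elim x)
      then show ?case using that by (cases ?e) auto
    qed
  qed
  moreover have "?e < \<infinity> \<and> real_of_ereal ?e \<le> 1"
    if "g \<in> borel_measurable M" "AE x in M. \<bar>g x\<bar> \<le> 1"
  proof -
    have "?e \<le> 1" using that by (intro esssup_I) (auto simp: one_ereal_def)
    then show ?thesis by (cases ?e) auto
  qed
  ultimately show ?thesis by (auto simp: Lball_def Lspace_def Lnorm_def)
qed

lemma Lspace_iff: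
  "u \<in> Lspace M (ereal p) \<longleftrightarrow> u \<in> borel_measurable M \<and> integrable M (\<lambda>x. \<bar>u x\<bar> powr p)"
  by (simp add: Lspace_def)

lemma Lnorm_ereal: "Lnorm M (ereal p) u = (\<integral>x. \<bar>u x\<bar> powr p \<partial>M) powr (1 / p)"
  by (simp add: Lnorm_def)

lemma Lnorm_one: "Lnorm M 1 u = (\<integral>x. \<bar>u x\<bar> \<partial>M)"
  using Lnorm_ereal[of M 1 u] by (simp add: one_ereal_def)

lemma Lspace_one_iff: "u \<in> Lspace M 1 \<longleftrightarrow> integrable M u"
proof -
  have "u \<in> borel_measurable M \<and> integrable M (\<lambda>x. \<bar>u x\<bar>) \<longleftrightarrow> integrable M u"
    by (metis borel_measurable_integrable integrable_abs integrable_abs_iff)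
  then show ?thesis using Lspace_iff[of u M 1] by (simp add: one_ereal_def)
qed

lemma Lnorm_nonneg: "0 \<le> Lnorm M (ereal p) u"
  by (simp add: Lnorm_ereal)

lemma Lnorm_powr:
  assumes "p > 0"
  shows "Lnorm M (ereal p) u powr p = (\<integral>x. \<bar>u x\<bar> powr p \<partial>M)"
  using assms by (simp add: Lnorm_ereal powr_powr)

section \<open>Vector space structure of \<open>Lspace\<close>\<close>

lemma Lspace_scale:
  assumes "u \<in> Lspace M (ereal p)"
  shows "(\<lambda>x. c * u x) \<in> Lspace M (ereal p)"
  using assms by (auto simp: Lspace_iff abs_mult powr_mult)

lemma Lspace_add:
  assumes "p \<ge> 1" "u \<in> Lspace M (ereal p)" "v \<in> Lspace M (ereal p)"
  shows "(\<lambda>x. u x + v x) \<in> Lspace M (ereal p)"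
proof -
  have [measurable]: "u \<in> borel_measurable M" "v \<in> borel_measurable M"
    using assms by (auto simp: Lspace_iff)
  have *: "\<bar>a + b\<bar> powr p \<le> 2 powr p * (\<bar>a\<bar> powr p + \<bar>b\<bar> powr p)" for a b :: real
  proof -
    have "\<bar>a + b\<bar> powr p \<le> (2 * max \<bar>a\<bar> \<bar>b\<bar>) powr p"
      using assms(1) by (intro powr_mono2) auto
    also have "\<dots> = 2 powr p * max \<bar>a\<bar> \<bar>b\<bar> powr p"
      by (simp add: powr_mult)
    also have "\<dots> \<le> 2 powr p * (\<bar>a\<bar> powr p + \<bar>b\<bar> powr p)"
      by (intro mult_left_mono) (auto simp: max_def)
    finally show ?thesis .
  qed
  have "integrable M (\<lambda>x. \<bar>u x + v x\<bar> powr p)"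
    by (rule Bochner_Integration.integrable_bound
        [of _ "\<lambda>x. 2 powr p * (\<bar>u x\<bar> powr p + \<bar>v x\<bar> powr p)"])
      (use assms * in \<open>auto simp: Lspace_iff intro!: AE_I2\<close>)
  then show ?thesis by (simp add: Lspace_iff)
qed

lemma Lspace_sum:
  assumes "p \<ge> 1" "\<And>i. i \<in> I \<Longrightarrow> u i \<in> Lspace M (ereal p)"
  shows "(\<lambda>x. \<Sum>i\<in>I. c i * u i x) \<in> Lspace M (ereal p)"
  using assms(2)
proof (induction I rule: infinite_finite_induct)
  case (insert i I)
  then show ?case
    by (simp, intro Lspace_add[OF assms(1)] Lspace_scale) auto
qed (use assms(1) in \<open>simp_all add: Lspace_iff\<close>)

lemma Lspace_diff:
  assumes "p \<ge> 1" "u \<in> Lspace M (ereal p)" "v \<in> Lspace M (ereal p)"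
  shows "(\<lambda>x. u x - v x) \<in> Lspace M (ereal p)"
  using Lspace_add[OF assms(1,2) Lspace_scale[OF assms(3), of "-1"]] by simp

lemma Lnorm_eq_0_imp_AE:
  assumes "p > 0" "u \<in> Lspace M (ereal p)" "Lnorm M (ereal p) u = 0"
  shows "AE x in M. u x = 0"
proof -
  have "(\<integral>x. \<bar>u x\<bar> powr p \<partial>M) = 0"
    using Lnorm_powr[OF assms(1), of M u] assms by simp
  then have "AE x in M. \<bar>u x\<bar> powr p = 0"
    using assms by (subst (asm) integral_nonneg_eq_0_iff_AE) (auto simp: Lspace_iff)
  then show ?thesis by simp
qed

section \<open>Hoelder's inequality and its case of equality\<close>

lemma conj_exp_1: "conj_exp 1 = \<infinity>" by (simp add: conj_exp_def)
lemma conj_exp_gt_1: "p > 1 \<Longrightarrow> conj_exp p = ereal (p / (p - 1))" by (simp add: conj_exp_def)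

lemma Lball_ereal_iff:
  assumes "q > 0"
  shows "g \<in> Lball M (ereal q) \<longleftrightarrow> g \<in> borel_measurable M \<and>
    integrable M (\<lambda>x. \<bar>g x\<bar> powr q) \<and> (\<integral>x. \<bar>g x\<bar> powr q \<partial>M) \<le> 1"
proof -
  have "x powr (1/q) \<le> 1 \<longleftrightarrow> x \<le> 1" if "0 \<le> x" for x :: real
  proof
    assume "x powr (1/q) \<le> 1"
    then have "(x powr (1/q)) powr q \<le> 1 powr q"
      using assms by (intro powr_mono2) auto
    then show "x \<le> 1" using assms that by (simp add: powr_powr)
  next
    assume "x \<le> 1"
    then have "x powr (1/q) \<le> 1 powr (1/q)"
      using assms that by (intro powr_mono2) auto
    then show "x powr (1/q) \<le> 1" by simp
  qed
  then show ?thesis by (auto simp: Lball_def Lspace_iff Lnorm_ereal)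
qed

text \<open>For \<open>p = 1\<close> the multiplier is bounded by 1 almost everywhere. For
  \<open>p > 1\<close> Young's inequality is integrated after normalising \<open>u\<close>, which is
  why norm zero is treated apart.\<close>

proposition Hoelder_Lball:
  assumes p: "p \<ge> 1" and u: "u \<in> Lspace M (ereal p)" and g: "g \<in> Lball M (conj_exp p)"
  shows "integrable M (\<lambda>x. g x * u x)" "(\<integral>x. g x * u x \<partial>M) \<le> Lnorm M (ereal p) u"
proof -
  have "integrable M (\<lambda>x. g x * u x) \<and> (\<integral>x. g x * u x \<partial>M) \<le> Lnorm M (ereal p) u"
  proof (cases "p = 1")
    case True
    have iu: "integrable M u" using u True by (simp add: Lspace_one_iff flip: one_ereal_def)
    have [measurable]: "g \<in> borel_measurable M" and g1: "AE x in M. \<bar>g x\<bar> \<le> 1"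
      using g True by (auto simp: conj_exp_1 Lball_infinity_iff)
    have le: "AE x in M. \<bar>g x * u x\<bar> \<le> \<bar>u x\<bar>"
      using g1 by eventually_elim (simp add: abs_mult mult_left_le_one_le)
    have [measurable]: "u \<in> borel_measurable M" using iu by auto
    have int: "integrable M (\<lambda>x. g x * u x)"
      by (rule Bochner_Integration.integrable_bound[OF iu]) (use le in auto)
    moreover have "(\<integral>x. g x * u x \<partial>M) \<le> (\<integral>x. \<bar>u x\<bar> \<partial>M)"
    proof (rule integral_mono_AE[OF int])
      show "AE x in M. g x * u x \<le> \<bar>u x\<bar>" using le by eventually_elim linarith
    qed (use iu in auto)
    ultimately show ?thesis using True by (simp add: Lnorm_one flip: one_ereal_def)
  next
    case False
    then have p1: "p > 1" using p by simp
    define q where "q = p / (p - 1)"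
    have q: "q > 1" "1/p + 1/q = 1" using p1 by (auto simp: q_def field_simps)
    have [measurable]: "g \<in> borel_measurable M" "u \<in> borel_measurable M"
      and gi: "integrable M (\<lambda>x. \<bar>g x\<bar> powr q)" and g1: "(\<integral>x. \<bar>g x\<bar> powr q \<partial>M) \<le> 1"
      and ui: "integrable M (\<lambda>x. \<bar>u x\<bar> powr p)"
      using g u q p1 by (auto simp: conj_exp_gt_1 Lball_ereal_iff Lspace_iff simp flip: q_def)
    let ?N = "Lnorm M (ereal p) u"
    show ?thesis
    proof (cases "?N = 0")
      case True
      then have "AE x in M. u x = 0" using p by (intro Lnorm_eq_0_imp_AE[OF _ u]) auto
      then have 0: "AE x in M. g x * u x = 0" by eventually_elim simp
      then have "integrable M (\<lambda>x. g x * u x)"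
        by (subst integrable_cong_AE[of _ _ "\<lambda>_. 0"]) auto
      moreover have "(\<integral>x. g x * u x \<partial>M) = 0" by (rule integral_eq_zero_AE[OF 0])
      ultimately show ?thesis using True by simp
    next
      case False
      then have N: "?N > 0" using Lnorm_nonneg[of M p u] by linarith
      \<comment> \<open>Young's bound for \<open>u / ?N\<close> and \<open>g\<close>, rescaled by
        \<open>?N\<close>. It serves both as the integrable majorant and for the constant, since its
        integral is at most \<open>?N * (1 / p + 1 / q)\<close>.\<close>
      let ?b = "\<lambda>x. ?N * (\<bar>u x\<bar> powr p / (?N powr p) / p + \<bar>g x\<bar> powr q / q)"
      have bi: "integrable M ?b" using gi ui by simp
      have le: "\<bar>g x * u x\<bar> \<le> ?b x" for x
      proof -
        have "\<bar>u x / ?N\<bar> * \<bar>g x\<bar> \<le> \<bar>u x / ?N\<bar> powr p / p + \<bar>g x\<bar> powr q / q"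
          by (rule Youngs_inequality) (use p1 q in auto)
        then have "?N * (\<bar>u x / ?N\<bar> * \<bar>g x\<bar>) \<le> ?N * (\<bar>u x / ?N\<bar> powr p / p + \<bar>g x\<bar> powr q / q)"
          using N by (intro mult_left_mono) auto
        moreover have "?N * (\<bar>u x / ?N\<bar> * \<bar>g x\<bar>) = \<bar>g x * u x\<bar>"
          using N by (simp add: abs_mult)
        ultimately show ?thesis using N by (simp add: powr_divide)
      qed
      have int: "integrable M (\<lambda>x. g x * u x)"
        by (rule Bochner_Integration.integrable_bound[OF bi])
          (auto intro!: AE_I2 order_trans[OF le])
      have "(\<integral>x. g x * u x \<partial>M) \<le> (\<integral>x. ?b x \<partial>M)"
        by (rule integral_mono[OF int bi]) (use le in \<open>auto intro: order_trans[OF abs_ge_self]\<close>)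
      also have "\<dots> = ?N * ((\<integral>x. \<bar>u x\<bar> powr p \<partial>M) / (?N powr p) / p + (\<integral>x. \<bar>g x\<bar> powr q \<partial>M) / q)"
        using gi ui by simp
      also have "\<dots> = ?N * (1 / p + (\<integral>x. \<bar>g x\<bar> powr q \<partial>M) / q)"
        using N p1 by (simp flip: Lnorm_powr)
      also have "\<dots> \<le> ?N * (1 / p + 1 / q)"
        using N q g1 by (intro mult_left_mono add_left_mono divide_right_mono) auto
      finally show ?thesis using int q by simp
    qed
  qed
  then show "integrable M (\<lambda>x. g x * u x)" "(\<integral>x. g x * u x \<partial>M) \<le> Lnorm M (ereal p) u" by auto
qed

lemma zero_in_Lball: "p \<ge> 1 \<Longrightarrow> (\<lambda>_. 0) \<in> Lball M (conj_exp p)"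
  by (cases "p = 1") (auto simp: conj_exp_1 conj_exp_gt_1 Lball_infinity_iff Lball_ereal_iff)

text \<open>The equality case of Hoelder: as \<open>(p - 1) * q = p\<close>, the power
  \<open>\<bar>g x\<bar> powr q\<close> is the normalised \<open>\<bar>u x\<bar> powr p\<close>, and
  \<open>g x * u x\<close> is a multiple of the same power.\<close>

lemma norming_function_in_Lball:
  assumes p: "p > 1" and u: "u \<in> Lspace M (ereal p)" and N: "Lnorm M (ereal p) u > 0"
  defines "g \<equiv> \<lambda>x. sgn (u x) * \<bar>u x\<bar> powr (p - 1) / Lnorm M (ereal p) u powr (p - 1)"
  shows "g \<in> Lball M (conj_exp p)" "(\<integral>x. g x * u x \<partial>M) = Lnorm M (ereal p) u"
proof -
  let ?N = "Lnorm M (ereal p) u"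
  define q where "q = p / (p - 1)"
  have q: "q > 1" "(p - 1) * q = p" using p by (auto simp: q_def field_simps)
  have [measurable]: "u \<in> borel_measurable M" and ui: "integrable M (\<lambda>x. \<bar>u x\<bar> powr p)"
    using u by (auto simp: Lspace_iff)
  have I: "(\<integral>x. \<bar>u x\<bar> powr p \<partial>M) = ?N powr p" using p by (simp add: Lnorm_powr)
  have gq: "\<bar>g x\<bar> powr q = \<bar>u x\<bar> powr p / ?N powr p" for x
  proof -
    have "\<bar>g x\<bar> = (\<bar>u x\<bar> / ?N) powr (p - 1)"
      using N by (auto simp: g_def abs_mult sgn_if powr_divide)
    then show ?thesis using N q by (simp add: powr_powr powr_divide)
  qed
  have "g \<in> borel_measurable M" unfolding g_def by measurable
  then show "g \<in> Lball M (conj_exp p)"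
    using p q ui N I gq by (simp add: conj_exp_gt_1 Lball_ereal_iff flip: q_def)
  have "g x * u x = \<bar>u x\<bar> powr p / ?N powr (p - 1)" for x
  proof -
    have "g x * u x = \<bar>u x\<bar> * \<bar>u x\<bar> powr (p - 1) / ?N powr (p - 1)"
      by (simp add: g_def abs_sgn mult_ac)
    also have "\<bar>u x\<bar> * \<bar>u x\<bar> powr (p - 1) = \<bar>u x\<bar> powr p"
      by (simp add: powr_mult_base)
    finally show ?thesis .
  qed
  then have "(\<integral>x. g x * u x \<partial>M) = ?N powr p / ?N powr (p - 1)" using I by simp
  also have "\<dots> = ?N" using N by (simp flip: powr_diff)
  finally show "(\<integral>x. g x * u x \<partial>M) = ?N" .
qed

text \<open>Together with Hoelder this makes the norm a maximum over the dual ball. The sign of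
  \<open>u\<close> serves for \<open>p = 1\<close>, and zero serves when the norm vanishes.\<close>

proposition Lnorm_attained:
  assumes p: "p \<ge> 1" and u: "u \<in> Lspace M (ereal p)"
  obtains g where "g \<in> Lball M (conj_exp p)" "(\<integral>x. g x * u x \<partial>M) = Lnorm M (ereal p) u"
proof -
  consider "p = 1" | "p > 1" "Lnorm M (ereal p) u = 0" | "p > 1" "Lnorm M (ereal p) u > 0"
    using p Lnorm_nonneg[of M p u] by linarith
  then show thesis
  proof cases
    case 1
    have [measurable]: "u \<in> borel_measurable M" using u by (auto simp: Lspace_iff)
    show thesis
      by (rule that[of "\<lambda>x. sgn (u x)"])
        (use 1 in \<open>auto simp: conj_exp_1 Lball_infinity_iff Lnorm_one sgn_if abs_sgn mult.commute
          simp flip: one_ereal_def intro!: AE_I2 Bochner_Integration.integral_cong\<close>)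
  next
    case 2
    then show thesis using zero_in_Lball[OF p] by (intro that[of "\<lambda>_. 0"]) auto
  next
    case 3
    then show thesis using norming_function_in_Lball[of p u M] u that by blast
  qed
qed

lemma Lball_uminus: "g \<in> Lball M (conj_exp p) \<Longrightarrow> (\<lambda>x. - g x) \<in> Lball M (conj_exp p)"
  by (auto simp: Lball_def Lspace_def Lnorm_def)

text \<open>Minkowski's inequality by duality: a function norming the sum is tested on both
  summands.\<close>

lemma Lnorm_add_le:
  assumes p: "p \<ge> 1" and u: "u \<in> Lspace M (ereal p)" and v: "v \<in> Lspace M (ereal p)"
  shows "Lnorm M (ereal p) (\<lambda>x. u x + v x) \<le> Lnorm M (ereal p) u + Lnorm M (ereal p) v"
proof -
  obtain g where g: "g \<in> Lball M (conj_exp p)"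
    "(\<integral>x. g x * (u x + v x) \<partial>M) = Lnorm M (ereal p) (\<lambda>x. u x + v x)"
    using Lnorm_attained[OF p Lspace_add[OF assms]] .
  have "(\<integral>x. g x * (u x + v x) \<partial>M) = (\<integral>x. g x * u x \<partial>M) + (\<integral>x. g x * v x \<partial>M)"
    using Hoelder_Lball(1)[OF p u g(1)] Hoelder_Lball(1)[OF p v g(1)] by (simp add: distrib_left)
  then show ?thesis
    using g(2) Hoelder_Lball(2)[OF p u g(1)] Hoelder_Lball(2)[OF p v g(1)] by linarith
qed

lemma Lnorm_scale:
  assumes "p \<ge> 1"
  shows "Lnorm M (ereal p) (\<lambda>x. c * u x) = \<bar>c\<bar> * Lnorm M (ereal p) u"
  using assms by (simp add: Lnorm_ereal abs_mult powr_mult powr_powr)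

lemma abs_integral_Lball_le:
  assumes "p \<ge> 1" "u \<in> Lspace M (ereal p)" "g \<in> Lball M (conj_exp p)"
  shows "\<bar>\<integral>x. g x * u x \<partial>M\<bar> \<le> Lnorm M (ereal p) u"
  using Hoelder_Lball(2)[OF assms] Hoelder_Lball(2)[OF assms(1,2) Lball_uminus[OF assms(3)]] by simp

lemma Lnorm_diff_le:
  assumes p: "p \<ge> 1" and u: "u \<in> Lspace M (ereal p)" and v: "v \<in> Lspace M (ereal p)"
  shows "\<bar>Lnorm M (ereal p) u - Lnorm M (ereal p) v\<bar> \<le> Lnorm M (ereal p) (\<lambda>x. u x - v x)"
proof -
  have "Lnorm M (ereal p) (\<lambda>x. v x - u x) = Lnorm M (ereal p) (\<lambda>x. u x - v x)"
    using Lnorm_scale[OF p, of M "-1" "\<lambda>x. u x - v x"] by simp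
  then show ?thesis
    using Lnorm_add_le[OF p Lspace_diff[OF p u v] v] Lnorm_add_le[OF p Lspace_diff[OF p v u] u]
    by simp
qed

lemma integral_Lball_sum:
  assumes p: "p \<ge> 1" and "\<And>i. i \<in> I \<Longrightarrow> u i \<in> Lspace M (ereal p)" and g: "g \<in> Lball M (conj_exp p)"
  shows "(\<integral>x. g x * (\<Sum>i\<in>I. c i * u i x) \<partial>M) = (\<Sum>i\<in>I. c i * (\<integral>x. g x * u i x \<partial>M))"
proof -
  have "integrable M (\<lambda>x. c i * (g x * u i x))" if "i \<in> I" for i
    using Hoelder_Lball(1)[OF p assms(2)[OF that] g] by simp
  then have "(\<integral>x. (\<Sum>i\<in>I. c i * (g x * u i x)) \<partial>M) = (\<Sum>i\<in>I. (\<integral>x. c i * (g x * u i x) \<partial>M))"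
    by (rule Bochner_Integration.integral_sum)
  then show ?thesis by (simp add: sum_distrib_left mult_ac)
qed

section \<open>Convexity in finite dimensions\<close>

text \<open>The first-order condition at a minimum, in the form in which the minimality arguments
  below use it: a quadratic error cannot compensate a negative slope.\<close>

lemma nonneg_if_quadratic_nonneg:
  fixes D Q :: real
  assumes "\<And>t. 0 < t \<Longrightarrow> t \<le> 1 \<Longrightarrow> 0 \<le> t * D + t\<^sup>2 * Q"
  shows "0 \<le> D"
proof (rule ccontr)
  assume "\<not> 0 \<le> D"
  then have D: "D < 0" by simp
  \<comment> \<open>Small enough that \<open>t * Q\<close> is at most \<open>- D / 2\<close>; the
    added 1 keeps the denominator positive.\<close>
  define t where "t = min 1 (- D / (2 * (\<bar>Q\<bar> + 1)))"
  have t: "0 < t" "t \<le> 1" using D by (auto simp: t_def intro!: divide_neg_pos)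
  have "t * Q \<le> t * (\<bar>Q\<bar> + 1)" using t by (intro mult_left_mono) auto
  also have "\<dots> \<le> - D / (2 * (\<bar>Q\<bar> + 1)) * (\<bar>Q\<bar> + 1)"
    by (intro mult_right_mono) (auto simp: t_def)
  also have "\<dots> = - D / 2" by (simp add: field_simps)
  finally have "D + t * Q < 0" using D by simp
  then have "t * (D + t * Q) < 0" using t by (simp add: mult_pos_neg)
  moreover have "t * (D + t * Q) = t * D + t\<^sup>2 * Q" by (simp add: power2_eq_square algebra_simps)
  ultimately show False using assms[OF t] by linarith
qed

text \<open>Gaussian elimination: the last equation is solved for an unknown \<open>k\<close> that
  occurs in it, which removes one equation and one unknown.\<close>

lemma homogeneous_system_nontrivial_solution:
  fixes a :: "'i \<Rightarrow> nat \<Rightarrow> real"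
  assumes "finite I" "m < card I"
  shows "\<exists>\<mu>. (\<exists>i\<in>I. \<mu> i \<noteq> 0) \<and> (\<forall>j<m. (\<Sum>i\<in>I. \<mu> i * a i j) = 0)"
  using assms
proof (induction m arbitrary: I a)
  case 0
  then have "I \<noteq> {}" by auto
  then show ?case by (intro exI[of _ "\<lambda>_. 1"]) auto
next
  case (Suc m)
  show ?case
  proof (cases "\<forall>i\<in>I. a i m = 0")
    case True
    obtain \<mu> where "\<exists>i\<in>I. \<mu> i \<noteq> 0" "\<forall>j<m. (\<Sum>i\<in>I. \<mu> i * a i j) = 0"
      using Suc.IH[of I a] Suc.prems by auto
    then show ?thesis using True by (intro exI[of _ \<mu>]) (auto simp: less_Suc_eq)
  next
    case False
    then obtain k where k: "k \<in> I" "a k m \<noteq> 0" by auto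
    define b where "b i j = a i j - a i m / a k m * a k j" for i j
    have "m < card (I - {k})" using Suc.prems k by simp
    then obtain \<mu> where \<mu>: "\<exists>i\<in>I - {k}. \<mu> i \<noteq> 0" "\<forall>j<m. (\<Sum>i\<in>I - {k}. \<mu> i * b i j) = 0"
      using Suc.IH[of "I - {k}" b] Suc.prems by auto
    \<comment> \<open>The value at \<open>k\<close> is the one that equation \<open>m\<close>
      forces.\<close>
    define \<nu> where "\<nu> = \<mu>(k := - (\<Sum>i\<in>I - {k}. \<mu> i * a i m) / a k m)"
    have *: "(\<Sum>i\<in>I. \<nu> i * a i j) = (\<Sum>i\<in>I - {k}. \<mu> i * b i j)" for j
    proof -
      have "(\<Sum>i\<in>I. \<nu> i * a i j) = \<nu> k * a k j + (\<Sum>i\<in>I - {k}. \<nu> i * a i j)"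
        using Suc.prems k by (subst sum.remove[of _ k]) auto
      also have "(\<Sum>i\<in>I - {k}. \<nu> i * a i j) = (\<Sum>i\<in>I - {k}. \<mu> i * a i j)"
        by (intro sum.cong) (auto simp: \<nu>_def)
      also have "\<nu> k * a k j = - (\<Sum>i\<in>I - {k}. \<mu> i * (a i m / a k m * a k j))"
        by (simp add: \<nu>_def sum_distrib_right sum_divide_distrib mult.assoc)
      finally show ?thesis by (simp add: b_def right_diff_distrib sum_subtractf)
    qed
    have "(\<Sum>i\<in>I. \<nu> i * a i j) = 0" if "j < Suc m" for j
    proof (cases "j = m")
      case True
      then show ?thesis using * k by (simp add: b_def)
    next
      case False
      then show ?thesis using * \<mu> that by simp
    qed
    moreover have "\<exists>i\<in>I. \<nu> i \<noteq> 0" using \<mu>(1) by (auto simp: \<nu>_def)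
    ultimately show ?thesis by blast
  qed
qed

text \<open>One step of Caratheodory's theorem: \<open>n + 2\<close> points in dimension
  \<open>n\<close> are affinely dependent, and the weights are shifted along a dependence until one
  of them vanishes.\<close>

lemma caratheodory_reduce:
  fixes Y :: "nat \<Rightarrow> nat \<Rightarrow> real"
  assumes l: "\<And>i. i \<le> Suc n \<Longrightarrow> 0 \<le> l i" "(\<Sum>i\<le>Suc n. l i) = 1"
    and Y: "\<And>i. i \<le> Suc n \<Longrightarrow> Y i \<in> K"
  shows "\<exists>l' Y'. (\<forall>i\<le>n. 0 \<le> l' i \<and> Y' i \<in> K) \<and> (\<Sum>i\<le>n. l' i) = (1::real) \<and>
    (\<forall>j<n. (\<Sum>i\<le>n. l' i * Y' i j) = (\<Sum>i\<le>Suc n. l i * Y i j))"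
proof -
  \<comment> \<open>Equation number \<open>n\<close> has all coefficients 1, so the dependence also
    has coefficient sum zero.\<close>
  obtain \<mu> where \<mu>: "\<exists>i\<in>{..Suc n}. \<mu> i \<noteq> 0"
    "\<forall>j<Suc n. (\<Sum>i\<in>{..Suc n}. \<mu> i * (if j < n then Y i j else 1)) = 0"
    using homogeneous_system_nontrivial_solution
      [of "{..Suc n}" "Suc n" "\<lambda>i j. if j < n then Y i j else 1"] by auto
  have \<mu>0: "(\<Sum>i\<le>Suc n. \<mu> i) = 0"
    using \<mu>(2)[rule_format, of n] by simp
  have \<mu>Y: "(\<Sum>i\<le>Suc n. \<mu> i * Y i j) = 0" if "j < n" for j
    using \<mu>(2)[rule_format, of j] that by simp
  have "\<exists>i\<le>Suc n. \<mu> i > 0"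
  proof (rule ccontr)
    assume "\<not> ?thesis"
    then have "\<forall>i\<in>{..Suc n}. 0 \<le> - \<mu> i" by force
    moreover have "(\<Sum>i\<le>Suc n. - \<mu> i) = 0" using \<mu>0 by (simp only: sum_negf)
    ultimately have "\<forall>i\<in>{..Suc n}. - \<mu> i = 0"
      by (subst (asm) sum_nonneg_eq_0_iff) auto
    then show False using \<mu>(1) by auto
  qed
  then obtain i1 where i1: "i1 \<le> Suc n" "\<mu> i1 > 0" by blast
  define P where "P = {i. i \<le> Suc n \<and> \<mu> i > 0}"
  have P: "finite P" "P \<noteq> {}" using i1 by (auto simp: P_def)
  \<comment> \<open>The smallest ratio is the longest shift that keeps every weight nonnegative; it
    annihilates the weight at \<open>k\<close>.\<close>
  define k where "k = arg_min_on (\<lambda>i. l i / \<mu> i) P"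
  have k: "k \<in> P" "\<And>i. i \<in> P \<Longrightarrow> l k / \<mu> k \<le> l i / \<mu> i"
    using arg_min_if_finite[OF P, of "\<lambda>i. l i / \<mu> i"] unfolding k_def
    by (auto simp: not_less)
  have k': "k \<le> Suc n" "\<mu> k > 0" using k by (auto simp: P_def)
  define w where "w i = l i - l k / \<mu> k * \<mu> i" for i
  have w0: "0 \<le> w i" if "i \<le> Suc n" for i
  proof (cases "\<mu> i > 0")
    case True
    then show ?thesis using k(2)[of i] that by (simp add: P_def w_def field_simps)
  next
    case False
    have "l k / \<mu> k * \<mu> i \<le> 0" using False k' l(1)[of k] by (intro mult_nonneg_nonpos) auto
    then show ?thesis using l(1)[OF that] by (simp add: w_def)
  qed
  have wk: "w k = 0" using k' by (simp add: w_def)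
  have sw: "(\<Sum>i\<le>Suc n. w i * z i) = (\<Sum>i\<le>Suc n. l i * z i)" if "(\<Sum>i\<le>Suc n. \<mu> i * z i) = 0" for z
  proof -
    have "(\<Sum>i\<le>Suc n. w i * z i) = (\<Sum>i\<le>Suc n. l i * z i) - l k / \<mu> k * (\<Sum>i\<le>Suc n. \<mu> i * z i)"
      by (simp only: w_def left_diff_distrib sum_subtractf sum_distrib_left mult.assoc)
    then show ?thesis using that by simp
  qed
  \<comment> \<open>The last point takes the vacated place \<open>k\<close>, so the surviving points
    are again numbered from 0 to \<open>n\<close>; for \<open>k = Suc n\<close> nothing
    moves.\<close>
  define l' where "l' i = w (if i = k then Suc n else i)" for i
  define Y' where "Y' i = Y (if i = k then Suc n else i)" for i
  have s: "(\<Sum>i\<le>n. w (if i = k then Suc n else i) * z (if i = k then Suc n else i)) = (\<Sum>i\<le>Suc n. w i * z i)"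
    for z :: "nat \<Rightarrow> real"
  proof (cases "k = Suc n")
    case True
    have "(\<Sum>i\<le>n. w (if i = k then Suc n else i) * z (if i = k then Suc n else i)) = (\<Sum>i\<le>n. w i * z i)"
      by (intro sum.cong) (auto simp: True)
    then show ?thesis using wk True by simp
  next
    case False
    then have kn: "k \<in> {..n}" using k' by auto
    have "(\<Sum>i\<le>n. w (if i = k then Suc n else i) * z (if i = k then Suc n else i)) =
      w (Suc n) * z (Suc n) + (\<Sum>i\<in>{..n} - {k}. w i * z i)"
      using kn by (subst sum.remove[of _ k]) (auto intro!: sum.cong)
    also have "(\<Sum>i\<in>{..n} - {k}. w i * z i) = (\<Sum>i\<le>n. w i * z i)"
      using kn wk by (subst (2) sum.remove[of _ k]) auto
    finally show ?thesis by simp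
  qed
  have "(\<Sum>i\<le>n. l' i) = 1"
    using s[of "\<lambda>_. 1"] sw[of "\<lambda>_. 1"] \<mu>0 l(2) by (simp add: l'_def)
  moreover have "(\<Sum>i\<le>n. l' i * Y' i j) = (\<Sum>i\<le>Suc n. l i * Y i j)" if "j < n" for j
    using s[of "\<lambda>i. Y i j"] sw[OF \<mu>Y[OF that]] by (simp only: l'_def Y'_def)
  moreover have "0 \<le> l' i \<and> Y' i \<in> K" if "i \<le> n" for i
    using that w0 Y by (auto simp: l'_def Y'_def)
  ultimately show ?thesis by blast
qed

text \<open>Tychonoff's theorem. Vectors are encoded as functions because the dimension is a number
  and not a type; boxes of such vectors are compact by this lemma.\<close>

lemma compact_PiE_UNIV:
  fixes S :: "'i \<Rightarrow> 'b::topological_space set"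
  assumes "\<And>i. compact (S i)"
  shows "compact (PiE UNIV S)"
  using compactin_PiE[of "\<lambda>_. euclidean" UNIV S] assms
  by (simp add: euclidean_product_topology)

text \<open>The point nearest to zero among the convex combinations of \<open>n + 1\<close> points
  of \<open>K\<close> is either zero or the normal of a separating hyperplane. It exists because
  these combinations depend continuously on a compact set of weights and points.\<close>

theorem gordan_caratheodory:
  fixes K :: "(nat \<Rightarrow> real) set"
  assumes K: "compact K"
  shows "(\<exists>c. \<forall>y\<in>K. 0 < (\<Sum>j<n. c j * y j)) \<or>
    (\<exists>l Y. (\<forall>i\<le>n. 0 \<le> l i \<and> Y i \<in> K) \<and> (\<Sum>i\<le>n. l i) = (1::real) \<and>
      (\<forall>j<n. (\<Sum>i\<le>n. l i * Y i j) = 0))"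
proof (cases "K = {}")
  case True
  then show ?thesis by simp
next
  case False
  then obtain y0 where y0: "y0 \<in> K" by auto
  \<comment> \<open>Entries of index above \<open>n\<close> do not enter the combination; they range
    over compact sets so that the whole product is compact, and \<open>inZ\<close> fills them with
    default values.\<close>
  define L where "L = PiE UNIV (\<lambda>_::nat. {0..1::real}) \<inter> {l. (\<Sum>i\<le>n. l i) = 1}"
  have cP: "compact (PiE UNIV (\<lambda>_::nat. {0..1::real}))" by (intro compact_PiE_UNIV compact_Icc)
  have "closed {l :: nat \<Rightarrow> real. (\<Sum>i\<le>n. l i) = 1}"
    by (intro closed_Collect_eq continuous_on_sum continuous_on_const) simp
  then have cL: "compact L" using cP unfolding L_def by (rule compact_Int_closed[rotated])
  define Z where "Z = L \<times> PiE UNIV (\<lambda>_::nat. K)"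
  have cZ: "compact Z" unfolding Z_def by (rule compact_Times[OF cL compact_PiE_UNIV[OF K]])
  have inZ: "((\<lambda>i. if i \<le> n then l i else 0), (\<lambda>i. if i \<le> n then Y i else y0)) \<in> Z"
    if lY: "\<forall>i\<le>n. 0 \<le> l i \<and> Y i \<in> K" "(\<Sum>i\<le>n. l i) = 1" for l Y
  proof -
    have "l i \<le> 1" if "i \<le> n" for i
      using member_le_sum[of i "{..n}" l] lY that by simp
    then show ?thesis using lY y0 by (auto simp: Z_def L_def PiE_iff)
  qed
  have "(\<lambda>i. if i = 0 then 1 else 0, \<lambda>_. y0) \<in> Z"
    using y0 by (auto simp: Z_def L_def sum.delta)
  then have "Z \<noteq> {}" by auto
  define F where "F z = (\<Sum>j<n. (\<Sum>i\<le>n. fst z i * snd z i j)\<^sup>2)" for z :: "(nat \<Rightarrow> real) \<times> (nat \<Rightarrow> nat \<Rightarrow> real)"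
  have "continuous_on Z (\<lambda>z. fst z i)" "continuous_on Z (\<lambda>z. snd z i j)" for i j
    using continuous_on_product_then_coordinatewise[OF continuous_on_fst[OF continuous_on_id], of Z]
      continuous_on_product_then_coordinatewise[OF continuous_on_product_then_coordinatewise
        [OF continuous_on_snd[OF continuous_on_id]], of Z] by blast+
  then have "continuous_on Z F"
    unfolding F_def by (intro continuous_on_sum continuous_on_power continuous_on_mult)
  then obtain z where z: "z \<in> Z" "\<And>z'. z' \<in> Z \<Longrightarrow> F z \<le> F z'"
    using continuous_attains_inf[OF cZ \<open>Z \<noteq> {}\<close> \<open>continuous_on Z F\<close>] by blast
  obtain l Y where lY: "z = (l, Y)" by (cases z)
  have l: "(\<Sum>i\<le>n. l i) = 1" "0 \<le> l i" and Y: "Y i \<in> K" for i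
    using z(1) by (auto simp: lY Z_def L_def)
  define v where "v j = (\<Sum>i\<le>n. l i * Y i j)" for j
  show ?thesis
  proof (cases "\<forall>j<n. v j = 0")
    case True
    then show ?thesis using l Y by (intro disjI2 exI[of _ l] exI[of _ Y]) (simp add: v_def)
  next
    case False
    then obtain j0 where "j0 < n" "v j0 \<noteq> 0" by auto
    then have Vpos: "0 < (\<Sum>j<n. (v j)\<^sup>2)" by (intro sum_pos2[of _ j0]) auto
    have "0 < (\<Sum>j<n. v j * y j)" if y: "y \<in> K" for y
    proof -
      \<comment> \<open>Moving from \<open>v\<close> towards \<open>y\<close> gives a combination of
        \<open>n + 2\<close> points. \<open>caratheodory_reduce\<close> rewrites it with
        \<open>n + 1\<close> points, so the minimality of \<open>z\<close> applies.\<close>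
      have *: "(\<Sum>j<n. (v j)\<^sup>2) \<le> (\<Sum>j<n. ((1 - t) * v j + t * y j)\<^sup>2)" if t: "0 < t" "t \<le> 1" for t
      proof -
        define l1 where "l1 i = (if i \<le> n then (1 - t) * l i else t)" for i
        define Y1 where "Y1 i = (if i \<le> n then Y i else y)" for i
        have s1: "(\<Sum>i\<le>Suc n. l1 i) = 1" using l(1) by (simp add: l1_def flip: sum_distrib_left)
        have "\<exists>l' Y'. (\<forall>i\<le>n. 0 \<le> l' i \<and> Y' i \<in> K) \<and> (\<Sum>i\<le>n. l' i) = 1 \<and>
          (\<forall>j<n. (\<Sum>i\<le>n. l' i * Y' i j) = (\<Sum>i\<le>Suc n. l1 i * Y1 i j))"
          by (rule caratheodory_reduce) (use s1 t l Y y in \<open>auto simp: l1_def Y1_def\<close>)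
        then obtain l' Y' where l': "\<forall>i\<le>n. 0 \<le> l' i \<and> Y' i \<in> K" "(\<Sum>i\<le>n. l' i) = 1"
          "\<forall>j<n. (\<Sum>i\<le>n. l' i * Y' i j) = (\<Sum>i\<le>Suc n. l1 i * Y1 i j)" by blast
        have "(\<Sum>i\<le>Suc n. l1 i * Y1 i j) = (1 - t) * v j + t * y j" for j
          by (simp add: l1_def Y1_def v_def sum_distrib_left mult.assoc)
        then have "F (\<lambda>i. if i \<le> n then l' i else 0, \<lambda>i. if i \<le> n then Y' i else y0) =
          (\<Sum>j<n. ((1 - t) * v j + t * y j)\<^sup>2)" using l'(3) by (simp add: F_def)
        moreover have "F z = (\<Sum>j<n. (v j)\<^sup>2)" by (simp add: F_def lY v_def)
        ultimately show ?thesis using z(2)[OF inZ[OF l'(1,2)]] by simp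
      qed
      \<comment> \<open>The variational inequality for the nearest point; it makes the inner product
        of \<open>v\<close> and \<open>y\<close> at least the squared length of \<open>v\<close>,
        which is positive.\<close>
      have "0 \<le> 2 * (\<Sum>j<n. v j * (y j - v j))"
      proof (rule nonneg_if_quadratic_nonneg)
        fix t :: real assume t: "0 < t" "t \<le> 1"
        have "((1 - t) * v j + t * y j)\<^sup>2 =
          (v j)\<^sup>2 + t * (2 * (v j * (y j - v j))) + t\<^sup>2 * (y j - v j)\<^sup>2" for j
          by (simp add: power2_eq_square algebra_simps)
        then show "0 \<le> t * (2 * (\<Sum>j<n. v j * (y j - v j))) + t\<^sup>2 * (\<Sum>j<n. (y j - v j)\<^sup>2)"
          using *[OF t] by (simp add: sum.distrib sum_distrib_left)
      qed
      then show ?thesis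
        using Vpos by (simp add: right_diff_distrib sum_subtractf power2_eq_square)
    qed
    then show ?thesis by blast
  qed
qed

section \<open>Densities of functionals on finite-dimensional subspaces\<close>

text \<open>Convergence in the product topology is coordinatewise, and the bound vanishes with the
  coordinate differences.\<close>

lemma continuous_on_UNIV_if_coordinatewise_Lipschitz:
  fixes F :: "('i \<Rightarrow> real) \<Rightarrow> real"
  assumes "\<And>c c'. \<bar>F c - F c'\<bar> \<le> (\<Sum>j\<in>J. \<bar>c j - c' j\<bar> * B j)"
  shows "continuous_on UNIV F"
  unfolding continuous_on_def
proof
  fix c :: "'i \<Rightarrow> real"
  have "((\<lambda>c'. c' j) \<longlongrightarrow> c j) (at c)" for j
    using continuous_on_product_coordinates[of j] unfolding continuous_on_def by blast
  then have "((\<lambda>c'. \<Sum>j\<in>J. \<bar>c' j - c j\<bar> * B j) \<longlongrightarrow> (\<Sum>j\<in>J. \<bar>c j - c j\<bar> * B j)) (at c)"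
    by (intro tendsto_intros)
  then have "((\<lambda>c'. \<Sum>j\<in>J. \<bar>c' j - c j\<bar> * B j) \<longlongrightarrow> 0) (at c)" by simp
  then have "((\<lambda>c'. F c' - F c) \<longlongrightarrow> 0) (at c)"
    by (rule Lim_null_comparison[rotated]) (simp add: assms)
  then show "(F \<longlongrightarrow> F c) (at c)" by (simp add: LIM_zero_iff)
qed

text \<open>The square root lies below its tangent at \<open>r\<^sup>2 + s\<^sup>2\<close>. Since
  \<open>\<bar>b\<bar>\<close> is at most \<open>r\<close>, the second-order term is bounded by a
  multiple of \<open>\<bar>b\<bar>\<close> itself, which stays integrable when \<open>b\<close> is
  the value of an integrable function.\<close>

lemma sqrt_pseudonorm_quadratic_bound:
  fixes r b s t :: real
  assumes "\<bar>b\<bar> \<le> r"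
  shows "sqrt (r\<^sup>2 + (s + t * b)\<^sup>2) \<le> sqrt (r\<^sup>2 + s\<^sup>2) + t * (s / sqrt (r\<^sup>2 + s\<^sup>2) * b) + t\<^sup>2 * (\<bar>b\<bar> / 2)"
proof (cases "r = 0")
  case True
  then show ?thesis using assms by simp
next
  case False
  then have r: "r > 0" using assms by linarith
  define R where "R = sqrt (r\<^sup>2 + s\<^sup>2)"
  have R2: "R\<^sup>2 = r\<^sup>2 + s\<^sup>2" by (simp add: R_def)
  have "sqrt (r\<^sup>2) \<le> R" unfolding R_def by (rule real_sqrt_le_mono) simp
  then have rR: "r \<le> R" using r by simp
  define w where "w = (2 * s * t * b + t\<^sup>2 * b\<^sup>2) / (2 * R)"
  have R0: "R > 0" using r rR by simp
  have w: "2 * R * w = 2 * s * t * b + t\<^sup>2 * b\<^sup>2" using R0 by (simp add: w_def)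
  have "(R + w)\<^sup>2 = R\<^sup>2 + (2 * R * w) + w\<^sup>2" by (simp add: power2_eq_square algebra_simps)
  also have "\<dots> = r\<^sup>2 + (s + t * b)\<^sup>2 + w\<^sup>2"
    unfolding w R2 by (simp add: power2_eq_square algebra_simps)
  finally have sq: "r\<^sup>2 + (s + t * b)\<^sup>2 \<le> (R + w)\<^sup>2" by simp
  have "2 * R * (R + w) = 2 * R\<^sup>2 + (2 * R * w)" by (simp add: power2_eq_square algebra_simps)
  also have "\<dots> = r\<^sup>2 + s\<^sup>2 + (r\<^sup>2 + (s + t * b)\<^sup>2)"
    unfolding w R2 by (simp add: power2_eq_square algebra_simps)
  finally have "0 \<le> 2 * R * (R + w)" by simp
  then have "0 \<le> R + w" using R0 by (simp add: zero_le_mult_iff)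
  then have 1: "sqrt (r\<^sup>2 + (s + t * b)\<^sup>2) \<le> R + w"
    using sq by (intro real_le_lsqrt)
  have "\<bar>b\<bar> * \<bar>b\<bar> \<le> \<bar>b\<bar> * R" using assms rR by (intro mult_left_mono) auto
  then have "b\<^sup>2 / (2 * R) \<le> \<bar>b\<bar> / 2" using R0 by (simp add: field_simps power2_eq_square)
  then have "t\<^sup>2 * (b\<^sup>2 / (2 * R)) \<le> t\<^sup>2 * (\<bar>b\<bar> / 2)" by (intro mult_left_mono) auto
  moreover have "w = t * (s / R * b) + t\<^sup>2 * (b\<^sup>2 / (2 * R))"
    using R0 by (simp add: w_def field_simps)
  ultimately show ?thesis using 1 unfolding R_def[symmetric] by linarith
qed

lemma sqrt_pseudonorm_Lipschitz: "\<bar>sqrt (r\<^sup>2 + s\<^sup>2) - sqrt (r\<^sup>2 + t\<^sup>2)\<bar> \<le> \<bar>s - t\<bar>" for r s t :: real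
  using norm_triangle_ineq3[of "(r, s)" "(r, t)"] by (simp add: norm_Pair)

text \<open>The minimiser of the smooth convex functional
  \<open>c \<mapsto> \<integral> sqrt (\<rho>\<^sup>2 + (\<Sum> c\<^sub>j u\<^sub>j)\<^sup>2) - c \<bullet> z\<close> exists because it dominates
  \<open>\<parallel>\<Sum> c\<^sub>j u\<^sub>j\<parallel> - c \<bullet> z\<close>, and its critical-point equation produces the density.\<close>

lemma L1_functional_density_strict:
  fixes u :: "'i \<Rightarrow> 'b \<Rightarrow> real"
  assumes J: "finite J" and u: "\<And>j. j \<in> J \<Longrightarrow> integrable M (u j)"
    and strict: "\<And>c k. k \<in> J \<Longrightarrow> c k \<noteq> 0 \<Longrightarrow> (\<Sum>j\<in>J. c j * z j) < (\<integral>x. \<bar>\<Sum>j\<in>J. c j * u j x\<bar> \<partial>M)"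
  shows "\<exists>g\<in>borel_measurable M. (\<forall>x. \<bar>g x\<bar> \<le> 1) \<and> (\<forall>j\<in>J. (\<integral>x. g x * u j x \<partial>M) = z j)"
proof (cases "J = {}")
  case True
  then show ?thesis by (intro bexI[of _ "\<lambda>_. 0"]) auto
next
  case False
  then obtain k0 where k0: "k0 \<in> J" by auto
  define U where "U c x = (\<Sum>j\<in>J. c j * u j x)" for c x
  define N where "N c = (\<integral>x. \<bar>U c x\<bar> \<partial>M)" for c
  define zz where "zz c = (\<Sum>j\<in>J. c j * z j)" for c
  have iU [simp]: "integrable M (U c)" for c unfolding U_def using u by auto
  have mu: "u j \<in> borel_measurable M" if "j \<in> J" for j using u[OF that] by auto
  have mU [measurable]: "U c \<in> borel_measurable M" for c by (rule borel_measurable_integrable[OF iU])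
  have Ud: "\<bar>U c x - U c' x\<bar> \<le> (\<Sum>j\<in>J. \<bar>c j - c' j\<bar> * \<bar>u j x\<bar>)" for c c' x
  proof -
    have "\<bar>U c x - U c' x\<bar> = \<bar>\<Sum>j\<in>J. (c j - c' j) * u j x\<bar>"
      by (simp add: U_def left_diff_distrib sum_subtractf)
    also have "\<dots> \<le> (\<Sum>j\<in>J. \<bar>(c j - c' j) * u j x\<bar>)" by (rule sum_abs)
    finally show ?thesis by (simp add: abs_mult)
  qed
  \<comment> \<open>One Lipschitz estimate for both the norm \<open>N\<close> and its smooth
    perturbation.\<close>
  have Ld: "\<bar>(\<integral>x. \<Psi> c x \<partial>M) - (\<integral>x. \<Psi> c' x \<partial>M)\<bar> \<le> (\<Sum>j\<in>J. \<bar>c j - c' j\<bar> * (\<integral>x. \<bar>u j x\<bar> \<partial>M))"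
    if i: "\<And>c. integrable M (\<Psi> c)" and d: "\<And>c c' x. \<bar>\<Psi> c x - \<Psi> c' x\<bar> \<le> \<bar>U c x - U c' x\<bar>"
    for \<Psi> :: "('i \<Rightarrow> real) \<Rightarrow> 'b \<Rightarrow> real" and c c'
  proof -
    have "\<bar>(\<integral>x. \<Psi> c x \<partial>M) - (\<integral>x. \<Psi> c' x \<partial>M)\<bar> = \<bar>\<integral>x. \<Psi> c x - \<Psi> c' x \<partial>M\<bar>" using i by simp
    also have "\<dots> \<le> (\<integral>x. \<bar>\<Psi> c x - \<Psi> c' x\<bar> \<partial>M)" by (rule integral_abs_bound)
    also have "\<dots> \<le> (\<integral>x. (\<Sum>j\<in>J. \<bar>c j - c' j\<bar> * \<bar>u j x\<bar>) \<partial>M)"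
      using i u by (intro integral_mono) (auto intro: order_trans[OF d Ud])
    also have "\<dots> = (\<Sum>j\<in>J. \<bar>c j - c' j\<bar> * (\<integral>x. \<bar>u j x\<bar> \<partial>M))" using u by simp
    finally show ?thesis .
  qed
  have zc: "continuous_on UNIV zz"
    unfolding zz_def by (intro continuous_on_sum continuous_on_mult continuous_on_const) simp
  have "continuous_on UNIV N"
    by (rule continuous_on_UNIV_if_coordinatewise_Lipschitz[where J = J and B = "\<lambda>j. \<integral>x. \<bar>u j x\<bar> \<partial>M"], unfold N_def, rule Ld) auto
  then have NC: "continuous_on S (\<lambda>c. N c - zz c)" for S
    using zc by (auto intro: continuous_on_diff continuous_on_subset)
  \<comment> \<open>Coordinates outside \<open>J\<close> are frozen at zero, which makes the box
    bounded in every coordinate of the index type.\<close>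
  define Bx where "Bx r = PiE UNIV (\<lambda>j. if j \<in> J then {-r..r} else {0::real})" for r
  have cBx: "compact (Bx r)" for r unfolding Bx_def by (rule compact_PiE_UNIV) auto
  define S where "S = Bx 1 \<inter> {c. (\<Sum>j\<in>J. \<bar>c j\<bar>) = 1}"
  have "closed {c :: 'i \<Rightarrow> real. (\<Sum>j\<in>J. \<bar>c j\<bar>) = 1}"
    by (intro closed_Collect_eq continuous_on_sum continuous_on_const continuous_on_rabs) simp
  then have cS: "compact S" unfolding S_def using cBx by (intro compact_Int_closed)
  have "(\<lambda>j. if j = k0 then 1 else 0) \<in> S"
    using k0 J by (auto simp: S_def Bx_def PiE_iff if_distrib[of abs] sum.delta cong: if_cong)
  then have "S \<noteq> {}" by auto
  obtain c1 where c1: "c1 \<in> S" "\<And>c. c \<in> S \<Longrightarrow> N c1 - zz c1 \<le> N c - zz c"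
    using continuous_attains_inf[OF cS \<open>S \<noteq> {}\<close> NC] by blast
  define \<delta> where "\<delta> = N c1 - zz c1"
  have "\<exists>k\<in>J. c1 k \<noteq> 0"
  proof (rule ccontr)
    assume "\<not> ?thesis"
    then have "(\<Sum>j\<in>J. \<bar>c1 j\<bar>) = 0" by simp
    then show False using c1(1) by (simp add: S_def)
  qed
  then have \<delta>: "\<delta> > 0" using strict[of _ c1] by (auto simp: \<delta>_def N_def zz_def U_def)
  \<comment> \<open>Strictness on the compact unit sphere gives the gap \<open>\<delta>\<close>, and
    homogeneity spreads it to all coefficient vectors.\<close>
  have coercive: "\<delta> * (\<Sum>j\<in>J. \<bar>c j\<bar>) \<le> N c - zz c" for c
  proof (cases "(\<Sum>j\<in>J. \<bar>c j\<bar>) = 0")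
    case True
    then have "\<forall>j\<in>J. c j = 0" using J by (simp add: sum_nonneg_eq_0_iff)
    then have "U c = (\<lambda>_. 0)" "zz c = 0" by (auto simp: U_def zz_def)
    then show ?thesis using True by (simp add: N_def)
  next
    case False
    define s where "s = (\<Sum>j\<in>J. \<bar>c j\<bar>)"
    have s: "s > 0" using False by (simp add: s_def order_less_le sum_nonneg)
    define d where "d j = (if j \<in> J then c j / s else 0)" for j
    have cs: "\<bar>c j\<bar> \<le> s" if "j \<in> J" for j unfolding s_def using that J by (intro member_le_sum) auto
    have "d j \<in> {-1..1}" if "j \<in> J" for j
      using s that cs[OF that] by (simp add: d_def field_simps abs_le_iff)
    moreover have "(\<Sum>j\<in>J. \<bar>d j\<bar>) = 1"
      using s by (simp add: d_def s_def flip: sum_divide_distrib)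
    ultimately have "d \<in> S" by (auto simp: S_def Bx_def PiE_iff d_def)
    then have "\<delta> \<le> N d - zz d" using c1 by (simp add: \<delta>_def)
    moreover have Uc: "U c x = s * U d x" for x
      using s by (auto simp: U_def d_def sum_distrib_left intro!: sum.cong)
    then have "N c = s * N d" using s by (simp add: N_def abs_mult)
    moreover have "zz c = s * zz d"
      using s by (auto simp: zz_def d_def sum_distrib_left intro!: sum.cong)
    ultimately show ?thesis using s by (simp add: mult.commute s_def[symmetric] flip: right_diff_distrib)
  qed
  \<comment> \<open>The smoothing weight dominates every \<open>\<bar>u j x\<bar>\<close>, as the
    quadratic bound requires, and is integrable, which a positive constant is not over a space of
    infinite measure.\<close>
  define \<rho> where "\<rho> x = (\<Sum>j\<in>J. \<bar>u j x\<bar>)" for x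
  have i\<rho> [simp]: "integrable M \<rho>" unfolding \<rho>_def using u by auto
  have [measurable]: "\<rho> \<in> borel_measurable M" by (rule borel_measurable_integrable[OF i\<rho>])
  have \<rho>0: "0 \<le> \<rho> x" for x by (simp add: \<rho>_def sum_nonneg)
  have u\<rho>: "\<bar>u j x\<bar> \<le> \<rho> x" if "j \<in> J" for j x
    unfolding \<rho>_def using that J by (intro member_le_sum) auto
  define \<psi> where "\<psi> c x = sqrt ((\<rho> x)\<^sup>2 + (U c x)\<^sup>2)" for c x
  have \<psi>U: "\<bar>U c x\<bar> \<le> \<psi> c x" for c x unfolding \<psi>_def by (rule real_le_rsqrt) simp
  have i\<psi> [simp]: "integrable M (\<psi> c)" for c
  proof (rule Bochner_Integration.integrable_bound[of _ "\<lambda>x. \<rho> x + \<bar>U c x\<bar>"])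
    show "\<psi> c \<in> borel_measurable M" unfolding \<psi>_def by measurable
    have "\<psi> c x \<le> \<rho> x + \<bar>U c x\<bar>" for x
      unfolding \<psi>_def using sqrt_sum_squares_le_sum_abs[of "\<rho> x" "U c x"] \<rho>0[of x] by simp
    then show "AE x in M. norm (\<psi> c x) \<le> norm (\<rho> x + \<bar>U c x\<bar>)"
      using \<rho>0 by (auto simp: \<psi>_def intro!: AE_I2)
  qed simp
  define \<Phi> where "\<Phi> c = (\<integral>x. \<psi> c x \<partial>M) - zz c" for c
  have \<Phi>N: "N c - zz c \<le> \<Phi> c" for c
    unfolding \<Phi>_def N_def by (intro diff_right_mono integral_mono) (auto intro: \<psi>U)
  have \<psi>L: "\<bar>\<psi> c x - \<psi> c' x\<bar> \<le> \<bar>U c x - U c' x\<bar>" for c c' x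
    unfolding \<psi>_def by (rule sqrt_pseudonorm_Lipschitz)
  have "continuous_on UNIV (\<lambda>c. \<integral>x. \<psi> c x \<partial>M)"
    by (rule continuous_on_UNIV_if_coordinatewise_Lipschitz[where J = J and B = "\<lambda>j. \<integral>x. \<bar>u j x\<bar> \<partial>M"],
        rule Ld[OF i\<psi> \<psi>L])
  then have \<Phi>C: "continuous_on S \<Phi>" for S
    unfolding \<Phi>_def using zc by (auto intro: continuous_on_diff continuous_on_subset)
  \<comment> \<open>Outside the box of radius \<open>R / \<delta>\<close> coercivity keeps
    \<open>\<Phi>\<close> at or above its value at zero, so a minimiser over the box is a global
    one.\<close>
  define R where "R = \<Phi> (\<lambda>_. 0)"
  have "N (\<lambda>_. 0) - zz (\<lambda>_. 0) \<le> R" unfolding R_def by (rule \<Phi>N)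
  then have R0: "0 \<le> R" by (simp add: N_def zz_def U_def)
  have 0: "(\<lambda>_. 0) \<in> Bx (R / \<delta>)" using R0 \<delta> by (auto simp: Bx_def)
  then have "Bx (R / \<delta>) \<noteq> {}" by auto
  then obtain c0 where c0: "c0 \<in> Bx (R / \<delta>)" "\<And>c. c \<in> Bx (R / \<delta>) \<Longrightarrow> \<Phi> c0 \<le> \<Phi> c"
    using continuous_attains_inf[OF cBx _ \<Phi>C] by blast
  have min: "\<Phi> c0 \<le> \<Phi> c" for c
  proof (cases "\<forall>j\<in>J. \<bar>c j\<bar> \<le> R / \<delta>")
    case True
    define d where "d j = (if j \<in> J then c j else 0)" for j
    have "d \<in> Bx (R / \<delta>)" using True by (auto simp: Bx_def d_def PiE_iff abs_le_iff)
    moreover have "U d = U c" "zz d = zz c" by (auto simp: U_def zz_def d_def intro!: sum.cong)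
    then have "\<Phi> d = \<Phi> c" by (simp add: \<Phi>_def \<psi>_def)
    ultimately show ?thesis using c0(2)[of d] by simp
  next
    case False
    then obtain j where j: "j \<in> J" "\<bar>c j\<bar> > R / \<delta>" by force
    have "\<bar>c j\<bar> \<le> (\<Sum>j\<in>J. \<bar>c j\<bar>)" using j J by (intro member_le_sum) auto
    then have "R / \<delta> \<le> (\<Sum>j\<in>J. \<bar>c j\<bar>)" using j by linarith
    then have "R \<le> \<delta> * (\<Sum>j\<in>J. \<bar>c j\<bar>)" using \<delta> by (simp add: field_simps)
    also have "\<dots> \<le> \<Phi> c" using coercive[of c] \<Phi>N[of c] by linarith
    finally show ?thesis using c0(2)[OF 0] by (simp add: R_def)
  qed
  define g where "g x = U c0 x / \<psi> c0 x" for x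
  have \<psi>m [measurable]: "\<psi> c0 \<in> borel_measurable M" by (rule borel_measurable_integrable[OF i\<psi>])
  have gm [measurable]: "g \<in> borel_measurable M" unfolding g_def by measurable
  have g1: "\<bar>g x\<bar> \<le> 1" for x
    using \<psi>U[of c0 x] by (cases "\<psi> c0 x = 0") (auto simp: g_def abs_divide divide_le_eq_1)
  have ig: "integrable M (\<lambda>x. g x * u j x)" if "j \<in> J" for j
  proof (rule Bochner_Integration.integrable_bound[OF u[OF that]])
    show "AE x in M. norm (g x * u j x) \<le> norm (u j x)"
      using g1 by (auto simp: abs_mult mult_left_le_one_le intro!: AE_I2)
  qed (use mu[OF that] in measurable)
  \<comment> \<open>The sign \<open>\<sigma>\<close> selects one of the two directions along
    coordinate \<open>j\<close>; the two inequalities together are the critical-point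
    equation.\<close>
  have half: "0 \<le> \<sigma> * ((\<integral>x. g x * u j x \<partial>M) - z j)" if j: "j \<in> J" and \<sigma>: "\<sigma>\<^sup>2 = 1" for j and \<sigma> :: real
  proof (rule nonneg_if_quadratic_nonneg)
    fix t :: real assume t: "0 < t" "t \<le> 1"
    define c where "c = c0(j := c0 j + t * \<sigma>)"
    have Uc: "U c x = U c0 x + t * \<sigma> * u j x" for x
    proof -
      have "U c x = (c0 j + t * \<sigma>) * u j x + (\<Sum>i\<in>J - {j}. c0 i * u i x)"
        unfolding U_def c_def using J j by (subst sum.remove[of _ j]) (auto intro!: sum.cong)
      also have "\<dots> = U c0 x + t * \<sigma> * u j x"
        unfolding U_def using J j by (subst (2) sum.remove[of _ j]) (auto simp: algebra_simps)
      finally show ?thesis .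
    qed
    have zc: "zz c = zz c0 + t * \<sigma> * z j"
    proof -
      have "zz c = (c0 j + t * \<sigma>) * z j + (\<Sum>i\<in>J - {j}. c0 i * z i)"
        unfolding zz_def c_def using J j by (subst sum.remove[of _ j]) (auto intro!: sum.cong)
      also have "\<dots> = zz c0 + t * \<sigma> * z j"
        unfolding zz_def using J j by (subst (2) sum.remove[of _ j]) (auto simp: algebra_simps)
      finally show ?thesis .
    qed
    have "(\<integral>x. \<psi> c x \<partial>M) \<le> (\<integral>x. \<psi> c0 x + t * \<sigma> * (g x * u j x) + t\<^sup>2 * (\<bar>u j x\<bar> / 2) \<partial>M)"
    proof (rule integral_mono)
      fix x
      show "\<psi> c x \<le> \<psi> c0 x + t * \<sigma> * (g x * u j x) + t\<^sup>2 * (\<bar>u j x\<bar> / 2)"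
        using sqrt_pseudonorm_quadratic_bound[OF u\<rho>[OF j], of x "U c0 x" "t * \<sigma>"] \<sigma>
        by (simp add: \<psi>_def Uc g_def power_mult_distrib)
    qed (use ig[OF j] u[OF j] in auto)
    also have "\<dots> = (\<integral>x. \<psi> c0 x \<partial>M) + t * \<sigma> * (\<integral>x. g x * u j x \<partial>M) + t\<^sup>2 * ((\<integral>x. \<bar>u j x\<bar> \<partial>M) / 2)"
      using ig[OF j] u[OF j] by simp
    finally have "\<Phi> c \<le> \<Phi> c0 + t * (\<sigma> * ((\<integral>x. g x * u j x \<partial>M) - z j)) + t\<^sup>2 * ((\<integral>x. \<bar>u j x\<bar> \<partial>M) / 2)"
      by (simp add: \<Phi>_def zc algebra_simps)
    then show "0 \<le> t * (\<sigma> * ((\<integral>x. g x * u j x \<partial>M) - z j)) + t\<^sup>2 * ((\<integral>x. \<bar>u j x\<bar> \<partial>M) / 2)"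
      using min[of c] by linarith
  qed
  have "(\<integral>x. g x * u j x \<partial>M) = z j" if "j \<in> J" for j
    using half[OF that, of 1] half[OF that, of "-1"] by simp
  then show ?thesis using gm g1 by blast
qed

text \<open>The limit is the one-sided derivative of the absolute value at \<open>a\<close> in
  direction \<open>b\<close>. For nonzero \<open>a\<close> the sign is eventually constant, and the
  quotients are eventually equal to their limit.\<close>

lemma abs_directional_derivative:
  fixes a b :: real
  shows "(\<lambda>m. real (Suc m) * (\<bar>a + b / real (Suc m)\<bar> - \<bar>a\<bar>))
    \<longlonglongrightarrow> sgn a * b + (if a = 0 then \<bar>b\<bar> else 0)"
proof (cases "a = 0")
  case True
  have "real (Suc m) * (\<bar>b\<bar> / real (Suc m)) = \<bar>b\<bar>" for m by simp
  then show ?thesis using True by (simp only:) (simp add: abs_divide)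
next
  case False
  have "(\<lambda>m. b / real (Suc m)) \<longlonglongrightarrow> 0"
    by (intro real_tendsto_divide_at_top[of _ b] filterlim_compose[OF filterlim_real_sequentially] filterlim_Suc tendsto_const)
  then have "eventually (\<lambda>m. \<bar>b / real (Suc m)\<bar> < \<bar>a\<bar>) sequentially"
    using False by (auto dest!: order_tendstoD(2)[OF tendsto_rabs, of _ _ _ "\<bar>a\<bar>"])
  then have "eventually (\<lambda>m. real (Suc m) * (\<bar>a + b / real (Suc m)\<bar> - \<bar>a\<bar>) = sgn a * b) sequentially"
  proof eventually_elim
    case (elim m)
    have "\<bar>a + e\<bar> - \<bar>a\<bar> = sgn a * e" if "\<bar>e\<bar> < \<bar>a\<bar>" for e
      using that by (auto simp: sgn_if abs_if split: if_splits)
    then have "\<bar>a + b / real (Suc m)\<bar> - \<bar>a\<bar> = sgn a * (b / real (Suc m))"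
      using elim by blast
    then show ?case by simp
  qed
  then show ?thesis using False by (simp add: tendsto_eventually)
qed

text \<open>When \<open>\<phi> c \<le> \<parallel>\<Sum> c\<^sub>j u\<^sub>j\<parallel>\<close> holds with equality for some \<open>c\<close>, the density is forced
  to be \<open>sgn (\<Sum> c\<^sub>j u\<^sub>j)\<close> off the zero set of that function, and on the zero set one of the
  \<open>u\<^sub>j\<close> is redundant.\<close>

lemma L1_functional_density:
  fixes u :: "'i \<Rightarrow> 'b \<Rightarrow> real"
  assumes "finite J" "\<And>j. j \<in> J \<Longrightarrow> integrable M (u j)"
    and "\<And>c. (\<Sum>j\<in>J. c j * z j) \<le> (\<integral>x. \<bar>\<Sum>j\<in>J. c j * u j x\<bar> \<partial>M)"
  shows "\<exists>g\<in>borel_measurable M. (\<forall>x. \<bar>g x\<bar> \<le> 1) \<and> (\<forall>j\<in>J. (\<integral>x. g x * u j x \<partial>M) = z j)"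
  using assms
proof (induction J arbitrary: u z rule: finite_psubset_induct)
  case (psubset J)
  note J = psubset.hyps and u = psubset.prems(1) and le = psubset.prems(2)
  show ?case
  proof (cases "\<forall>c. \<forall>k\<in>J. c k \<noteq> 0 \<longrightarrow> (\<Sum>j\<in>J. c j * z j) < (\<integral>x. \<bar>\<Sum>j\<in>J. c j * u j x\<bar> \<partial>M)")
    case True
    then show ?thesis by (intro L1_functional_density_strict J u) auto
  next
    case False
    then obtain c k where k: "k \<in> J" "c k \<noteq> 0"
      and "\<not> (\<Sum>j\<in>J. c j * z j) < (\<integral>x. \<bar>\<Sum>j\<in>J. c j * u j x\<bar> \<partial>M)" by blast
    then have eq: "(\<Sum>j\<in>J. c j * z j) = (\<integral>x. \<bar>\<Sum>j\<in>J. c j * u j x\<bar> \<partial>M)"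
      using le[of c] by linarith
    define U where "U c x = (\<Sum>j\<in>J. c j * u j x)" for c x
    have iU: "integrable M (U c)" for c unfolding U_def using u by auto
    have mU [measurable]: "U c \<in> borel_measurable M" for c by (rule borel_measurable_integrable[OF iU])
    define w where "w = U c"
    have iw: "integrable M w" and [measurable]: "w \<in> borel_measurable M" by (simp_all add: w_def iU)
    have bounded_mult: "integrable M (\<lambda>x. g x * v x)"
      if "g \<in> borel_measurable M" "\<And>x. \<bar>g x\<bar> \<le> 1" "integrable M v" for g v :: "'b \<Rightarrow> real"
      by (rule Bochner_Integration.integrable_bound[OF that(3)])
        (use that in \<open>auto simp: abs_mult mult_left_le_one_le intro!: AE_I2 borel_measurable_times\<close>)
    \<comment> \<open>\<open>S\<close> is the part of the density forced off the zeros of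
      \<open>w\<close>; \<open>\<zeta>\<close> is the indicator of the zero set, where freedom
      remains.\<close>
    define S where "S x = sgn (w x)" for x
    define \<zeta> where "\<zeta> x = (if w x = 0 then 1 else (0::real))" for x
    have [measurable]: "S \<in> borel_measurable M" "\<zeta> \<in> borel_measurable M"
      unfolding S_def \<zeta>_def by measurable
    have S1: "\<bar>S x\<bar> \<le> 1" and \<zeta>1: "\<bar>\<zeta> x\<bar> \<le> 1" for x by (auto simp: S_def \<zeta>_def sgn_if)
    \<comment> \<open>The norm minus the functional attains its minimum 0 at \<open>c\<close>, so
      its one-sided derivative in direction \<open>d\<close> is nonnegative; dominated convergence
      computes that derivative.\<close>
    have key: "(\<Sum>j\<in>J. d j * z j) - (\<integral>x. S x * U d x \<partial>M) \<le> (\<integral>x. \<zeta> x * \<bar>U d x\<bar> \<partial>M)" for d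
    proof -
      define s where "s m x = real (Suc m) * (\<bar>w x + U d x / real (Suc m)\<bar> - \<bar>w x\<bar>)" for m x
      have sb: "\<bar>s m x\<bar> \<le> \<bar>U d x\<bar>" for m x
      proof -
        have "\<bar>\<bar>w x + U d x / real (Suc m)\<bar> - \<bar>w x\<bar>\<bar> \<le> \<bar>U d x / real (Suc m)\<bar>" by linarith
        then have "real (Suc m) * \<bar>\<bar>w x + U d x / real (Suc m)\<bar> - \<bar>w x\<bar>\<bar> \<le> real (Suc m) * \<bar>U d x / real (Suc m)\<bar>"
          by (intro mult_left_mono) auto
        then show ?thesis by (simp add: s_def abs_mult abs_divide del: of_nat_Suc)
      qed
      have "(\<lambda>m. \<integral>x. s m x \<partial>M) \<longlonglongrightarrow> (\<integral>x. S x * U d x + \<zeta> x * \<bar>U d x\<bar> \<partial>M)"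
      proof (rule integral_dominated_convergence[where w = "\<lambda>x. \<bar>U d x\<bar>"])
        show "AE x in M. (\<lambda>m. s m x) \<longlonglongrightarrow> S x * U d x + \<zeta> x * \<bar>U d x\<bar>"
        proof (rule AE_I2)
          fix x
          show "(\<lambda>m. s m x) \<longlonglongrightarrow> S x * U d x + \<zeta> x * \<bar>U d x\<bar>"
            using abs_directional_derivative[of "w x" "U d x"] unfolding s_def S_def \<zeta>_def
            by (simp del: of_nat_Suc split: if_splits)
        qed
        show "s m \<in> borel_measurable M" for m unfolding s_def by measurable
      qed (use iU sb in auto)
      moreover have "(\<Sum>j\<in>J. d j * z j) \<le> (\<integral>x. s m x \<partial>M)" for m
      proof -
        define e where "e j = c j + d j / real (Suc m)" for j
        have Ue: "U e x = w x + U d x / real (Suc m)" for x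
          by (simp add: U_def w_def e_def distrib_right sum.distrib sum_divide_distrib)
        have "(\<Sum>j\<in>J. c j * z j) + (\<Sum>j\<in>J. d j * z j) / real (Suc m) = (\<Sum>j\<in>J. e j * z j)"
          by (simp add: e_def distrib_right sum.distrib sum_divide_distrib)
        also have "\<dots> \<le> (\<integral>x. \<bar>U e x\<bar> \<partial>M)" unfolding U_def by (rule le)
        finally have "(\<Sum>j\<in>J. d j * z j) / real (Suc m) \<le> (\<integral>x. \<bar>U e x\<bar> \<partial>M) - (\<integral>x. \<bar>w x\<bar> \<partial>M)"
          using eq by (simp add: w_def U_def)
        also have "\<dots> = (\<integral>x. \<bar>U e x\<bar> - \<bar>w x\<bar> \<partial>M)" using iU iw by simp
        finally have "(\<Sum>j\<in>J. d j * z j) \<le> real (Suc m) * (\<integral>x. \<bar>U e x\<bar> - \<bar>w x\<bar> \<partial>M)"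
          by (simp add: field_simps del: of_nat_Suc)
        then show ?thesis by (simp add: s_def Ue)
      qed
      ultimately have "(\<Sum>j\<in>J. d j * z j) \<le> (\<integral>x. S x * U d x + \<zeta> x * \<bar>U d x\<bar> \<partial>M)"
        by (intro LIMSEQ_le_const) auto
      also have "\<dots> = (\<integral>x. S x * U d x \<partial>M) + (\<integral>x. \<zeta> x * \<bar>U d x\<bar> \<partial>M)"
        using S1 \<zeta>1 iU by (intro Bochner_Integration.integral_add bounded_mult) auto
      finally show ?thesis by simp
    qed
    \<comment> \<open>The remaining problem: the functions are cut down to the zero set of
      \<open>w\<close>, and the values are reduced by what \<open>S\<close> already
      contributes.\<close>
    define u' where "u' j x = \<zeta> x * u j x" for j x
    define z' where "z' j = z j - (\<integral>x. S x * u j x \<partial>M)" for j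
    have iS: "integrable M (\<lambda>x. S x * u j x)" if "j \<in> J" for j
      using S1 u[OF that] by (intro bounded_mult) auto
    have iu': "integrable M (u' j)" if "j \<in> J" for j
      unfolding u'_def using \<zeta>1 u[OF that] by (intro bounded_mult) auto
    have le': "(\<Sum>j\<in>J - {k}. d j * z' j) \<le> (\<integral>x. \<bar>\<Sum>j\<in>J - {k}. d j * u' j x\<bar> \<partial>M)" for d
    proof -
      define e where "e = d(k := 0)"
      have e: "(\<Sum>j\<in>J. e j * q j) = (\<Sum>j\<in>J - {k}. d j * q j)" for q
        using J k by (subst sum.remove[of _ k]) (auto simp: e_def intro!: sum.cong)
      have "(\<integral>x. S x * U e x \<partial>M) = (\<integral>x. (\<Sum>j\<in>J - {k}. d j * (S x * u j x)) \<partial>M)"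
        by (simp add: U_def e sum_distrib_left mult_ac)
      also have "\<dots> = (\<Sum>j\<in>J - {k}. d j * (\<integral>x. S x * u j x \<partial>M))"
        using iS by (subst Bochner_Integration.integral_sum) auto
      finally have "(\<Sum>j\<in>J - {k}. d j * z' j) = (\<Sum>j\<in>J. e j * z j) - (\<integral>x. S x * U e x \<partial>M)"
        by (simp add: z'_def e right_diff_distrib sum_subtractf)
      also have "\<dots> \<le> (\<integral>x. \<zeta> x * \<bar>U e x\<bar> \<partial>M)" by (rule key)
      also have "(\<lambda>x. \<zeta> x * \<bar>U e x\<bar>) = (\<lambda>x. \<bar>\<Sum>j\<in>J - {k}. d j * u' j x\<bar>)"
      proof
        fix x
        have "(\<Sum>j\<in>J - {k}. d j * u' j x) = \<zeta> x * U e x"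
          by (simp add: U_def e u'_def sum_distrib_left mult_ac)
        then show "\<zeta> x * \<bar>U e x\<bar> = \<bar>\<Sum>j\<in>J - {k}. d j * u' j x\<bar>"
          by (simp add: abs_mult \<zeta>_def)
      qed
      finally show ?thesis .
    qed
    have "J - {k} \<subset> J" using k by auto
    then obtain g' where g' [measurable]: "g' \<in> borel_measurable M"
      and g'1: "\<And>x. \<bar>g' x\<bar> \<le> 1" and g'z: "\<And>j. j \<in> J - {k} \<Longrightarrow> (\<integral>x. g' x * u' j x \<partial>M) = z' j"
      using psubset.IH[of "J - {k}" u' z'] iu' le' by blast
    define g where "g x = S x + \<zeta> x * g' x" for x
    have gm [measurable]: "g \<in> borel_measurable M" unfolding g_def by measurable
    have g1: "\<bar>g x\<bar> \<le> 1" for x using g'1[of x] by (auto simp: g_def S_def \<zeta>_def sgn_if)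
    have gz: "(\<integral>x. g x * u j x \<partial>M) = z j" if "j \<in> J - {k}" for j
    proof -
      have "(\<integral>x. g x * u j x \<partial>M) = (\<integral>x. S x * u j x + g' x * u' j x \<partial>M)"
        by (simp add: g_def u'_def algebra_simps)
      also have "\<dots> = (\<integral>x. S x * u j x \<partial>M) + (\<integral>x. g' x * u' j x \<partial>M)"
        using that iu' g'1 by (intro Bochner_Integration.integral_add iS bounded_mult) auto
      finally show ?thesis using g'z[OF that] by (simp add: z'_def)
    qed
    \<comment> \<open>The value at \<open>k\<close>, which the induction does not provide, is
      recovered by testing \<open>g\<close> on \<open>w\<close>: there \<open>g x * w x\<close> is
      \<open>\<bar>w x\<bar>\<close>, and \<open>c k\<close> is nonzero.\<close>
    have "(\<Sum>j\<in>J. c j * (\<integral>x. g x * u j x \<partial>M)) = (\<integral>x. (\<Sum>j\<in>J. c j * (g x * u j x)) \<partial>M)"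
      using g1 u by (subst Bochner_Integration.integral_sum) (auto intro!: bounded_mult)
    also have "\<dots> = (\<integral>x. g x * w x \<partial>M)" by (simp add: w_def U_def sum_distrib_left mult_ac)
    also have "(\<lambda>x. g x * w x) = (\<lambda>x. \<bar>w x\<bar>)"
      by (auto simp: g_def S_def \<zeta>_def sgn_if)
    also have "(\<integral>x. \<bar>w x\<bar> \<partial>M) = (\<Sum>j\<in>J. c j * z j)" using eq by (simp add: w_def U_def)
    finally have "c k * (\<integral>x. g x * u k x \<partial>M) = c k * z k"
      using J k gz by (simp add: sum.remove[of J k])
    then have "(\<integral>x. g x * u j x \<partial>M) = z j" if "j \<in> J" for j using k gz that by (cases "j = k") auto
    then show ?thesis using gm g1 by blast
  qed
qed

text \<open>Splitting into the powers of the positive and the negative part avoids the jump of the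
  sign at zero.\<close>

lemma tendsto_signed_powr:
  fixes a :: real
  assumes "X \<longlonglongrightarrow> l" "a > 0"
  shows "(\<lambda>m. sgn (X m) * \<bar>X m\<bar> powr a) \<longlonglongrightarrow> sgn l * \<bar>l\<bar> powr a"
proof -
  have *: "sgn s * \<bar>s\<bar> powr a = max 0 s powr a - max 0 (- s) powr a" for s :: real
    by (auto simp: sgn_if max_def)
  have "(\<lambda>m. max 0 (X m) powr a - max 0 (- X m) powr a) \<longlonglongrightarrow> max 0 l powr a - max 0 (- l) powr a"
    using assms by (intro tendsto_diff tendsto_powr' tendsto_max tendsto_minus tendsto_const) auto
  then show ?thesis by (simp only: *)
qed

text \<open>For \<open>p > 1\<close> the norm is differentiable away from zero, so a supporting functional at \<open>r\<close>
  is the one given by the norming function of \<open>r\<close>.\<close>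

lemma Lp_supporting_functional:
  fixes p :: real
  assumes p: "p > 1" and r: "r \<in> Lspace M (ereal p)" and h: "h \<in> Lspace M (ereal p)"
    and N0: "Lnorm M (ereal p) r > 0"
    and supp: "\<And>t. Lnorm M (ereal p) r + t * y \<le> Lnorm M (ereal p) (\<lambda>x. r x + t * h x)"
  shows "(\<integral>x. sgn (r x) * \<bar>r x\<bar> powr (p - 1) / Lnorm M (ereal p) r powr (p - 1) * h x \<partial>M) = y"
proof -
  define v where "v t x = r x + t * h x" for t x
  define N where "N t = Lnorm M (ereal p) (v t)" for t
  have p1: "1 \<le> p" using p by simp
  have v: "v t \<in> Lspace M (ereal p)" for t
    unfolding v_def by (rule Lspace_add[OF p1 r Lspace_scale[OF h]])
  have v0: "v 0 = r" by (simp add: v_def fun_eq_iff)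
  have [measurable]: "r \<in> borel_measurable M" "h \<in> borel_measurable M"
    using r h by (auto simp: Lspace_iff)
  have suppN: "N 0 + t * y \<le> N t" for t
    using supp[of t] unfolding N_def v0 by (simp add: v_def[abs_def])
  have Nd: "\<bar>N t - N 0\<bar> \<le> \<bar>t\<bar> * Lnorm M (ereal p) h" for t
    using Lnorm_diff_le[OF p1 v[of t] v[of 0]] Lnorm_scale[OF p1, of M t h]
    by (simp add: N_def v_def)
  \<comment> \<open>The pairing of \<open>h\<close> with the norming function of \<open>v t\<close>,
    the candidate for the derivative of the norm along the line.\<close>
  define G where "G t = (\<integral>x. sgn (v t x) * \<bar>v t x\<bar> powr (p - 1) / N t powr (p - 1) * h x \<partial>M)" for t
  have half: "0 \<le> \<sigma> * (G 0 - y)" if \<sigma>: "\<bar>\<sigma>\<bar> = 1" for \<sigma>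
  proof -
    define t where "t m = \<sigma> / real (Suc m)" for m
    have t0: "t \<longlonglongrightarrow> 0" unfolding t_def
      by (intro real_tendsto_divide_at_top[of _ \<sigma>] filterlim_compose[OF filterlim_real_sequentially] filterlim_Suc tendsto_const)
    have "(\<lambda>m. \<bar>t m\<bar> * Lnorm M (ereal p) h) \<longlonglongrightarrow> 0"
      using tendsto_mult_right[OF tendsto_rabs[OF t0], of "Lnorm M (ereal p) h"] by simp
    then have "(\<lambda>m. N (t m) - N 0) \<longlonglongrightarrow> 0"
      by (rule Lim_null_comparison[rotated]) (auto intro!: always_eventually Nd)
    then have Nt: "(\<lambda>m. N (t m)) \<longlonglongrightarrow> N 0" by (simp add: LIM_zero_iff)
    have N00: "N 0 > 0" using N0 by (simp add: N_def v0)
    have "eventually (\<lambda>m. 0 \<le> \<sigma> * (G (t m) - y)) sequentially"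
      using order_tendstoD(1)[OF Nt N00]
    proof eventually_elim
      case (elim m)
      \<comment> \<open>The norming function of \<open>v (t m)\<close> has at most the value
        \<open>N 0\<close> on \<open>r\<close>, so \<open>N (t m)\<close> is at most
        \<open>N 0 + t m * G (t m)\<close>; compared with \<open>suppN\<close> this relates
        \<open>G (t m)\<close> to \<open>y\<close>, with the sign of \<open>t m\<close> deciding the
        direction.\<close>
      define g where "g x = sgn (v (t m) x) * \<bar>v (t m) x\<bar> powr (p - 1) / N (t m) powr (p - 1)" for x
      have g: "g \<in> Lball M (conj_exp p)" "(\<integral>x. g x * v (t m) x \<partial>M) = N (t m)"
        using norming_function_in_Lball[OF p v[of "t m"]] elim by (auto simp: N_def g_def[abs_def])
      have "g x * v (t m) x = g x * r x + t m * (g x * h x)" for x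
        by (simp add: v_def algebra_simps)
      then have "N (t m) = (\<integral>x. g x * r x + t m * (g x * h x) \<partial>M)"
        using g(2) by simp
      also have "\<dots> = (\<integral>x. g x * r x \<partial>M) + t m * G (t m)"
        using Hoelder_Lball(1)[OF p1 r g(1)] Hoelder_Lball(1)[OF p1 h g(1)]
        by (simp add: G_def flip: g_def)
      also have "\<dots> \<le> N 0 + t m * G (t m)"
        using Hoelder_Lball(2)[OF p1 r g(1)] by (simp add: N_def v0)
      finally have "t m * y \<le> t m * G (t m)"
        using suppN[of "t m"] by simp
      then have "0 \<le> t m * (G (t m) - y)" by (simp add: right_diff_distrib)
      then have "0 \<le> real (Suc m) * (t m * (G (t m) - y))"
        by (rule mult_nonneg_nonneg[OF of_nat_0_le_iff])
      then show ?case by (simp add: t_def del: of_nat_Suc)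
    qed
    moreover have "(\<lambda>m. \<sigma> * (G (t m) - y)) \<longlonglongrightarrow> \<sigma> * (G 0 - y)"
    proof -
      \<comment> \<open>Bounds both \<open>\<bar>h x\<bar>\<close> and, because
        \<open>\<bar>t m\<bar>\<close> is at most 1, every \<open>\<bar>v (t m) x\<bar>\<close>; the
        integrands are thus dominated by the \<open>p\<close>-th power of \<open>b\<close>.\<close>
      define b where "b x = \<bar>r x\<bar> + \<bar>h x\<bar>" for x
      have "(\<lambda>x. \<bar>r x\<bar>) \<in> Lspace M (ereal p)" "(\<lambda>x. \<bar>h x\<bar>) \<in> Lspace M (ereal p)"
        using r h by (auto simp: Lspace_iff)
      then have "b \<in> Lspace M (ereal p)" unfolding b_def by (rule Lspace_add[OF p1])
      then have ib: "integrable M (\<lambda>x. \<bar>b x\<bar> powr p)" by (simp add: Lspace_iff)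
      have "(\<lambda>m. \<integral>x. sgn (v (t m) x) * \<bar>v (t m) x\<bar> powr (p - 1) * h x \<partial>M)
        \<longlonglongrightarrow> (\<integral>x. sgn (v 0 x) * \<bar>v 0 x\<bar> powr (p - 1) * h x \<partial>M)"
      proof (rule integral_dominated_convergence[OF _ _ ib])
        show "AE x in M. (\<lambda>m. sgn (v (t m) x) * \<bar>v (t m) x\<bar> powr (p - 1) * h x)
          \<longlonglongrightarrow> sgn (v 0 x) * \<bar>v 0 x\<bar> powr (p - 1) * h x"
        proof (rule AE_I2)
          fix x
          have "(\<lambda>m. v (t m) x) \<longlonglongrightarrow> v 0 x"
            unfolding v_def by (intro tendsto_intros t0)
          then show "(\<lambda>m. sgn (v (t m) x) * \<bar>v (t m) x\<bar> powr (p - 1) * h x)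
            \<longlonglongrightarrow> sgn (v 0 x) * \<bar>v 0 x\<bar> powr (p - 1) * h x"
            using p by (intro tendsto_mult_right tendsto_signed_powr) auto
        qed
        show "AE x in M. norm (sgn (v (t m) x) * \<bar>v (t m) x\<bar> powr (p - 1) * h x) \<le> \<bar>b x\<bar> powr p" for m
        proof (rule AE_I2)
          fix x
          have "\<bar>t m\<bar> \<le> 1" using \<sigma> by (simp add: t_def abs_divide)
          then have "\<bar>t m * h x\<bar> \<le> \<bar>h x\<bar>" by (simp add: abs_mult mult_left_le_one_le)
          then have vb: "\<bar>v (t m) x\<bar> \<le> b x" unfolding v_def b_def by linarith
          have b0: "0 \<le> b x" by (simp add: b_def)
          have "norm (sgn (v (t m) x) * \<bar>v (t m) x\<bar> powr (p - 1) * h x)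
            \<le> \<bar>v (t m) x\<bar> powr (p - 1) * \<bar>h x\<bar>" by (auto simp: abs_mult sgn_if)
          also have "\<dots> \<le> b x powr (p - 1) * b x"
            using vb p by (intro mult_mono powr_mono2) (auto simp: b_def)
          also have "\<dots> = \<bar>b x\<bar> powr p" using b0 by (simp add: powr_mult_base mult.commute)
          finally show "norm (sgn (v (t m) x) * \<bar>v (t m) x\<bar> powr (p - 1) * h x) \<le> \<bar>b x\<bar> powr p" .
        qed
      qed (simp_all add: v_def)
      then have "(\<lambda>m. (\<integral>x. sgn (v (t m) x) * \<bar>v (t m) x\<bar> powr (p - 1) * h x \<partial>M) / N (t m) powr (p - 1))
        \<longlonglongrightarrow> (\<integral>x. sgn (v 0 x) * \<bar>v 0 x\<bar> powr (p - 1) * h x \<partial>M) / N 0 powr (p - 1)"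
        using Nt N00 p by (intro tendsto_divide tendsto_powr tendsto_const) auto
      moreover have "G s = (\<integral>x. sgn (v s x) * \<bar>v s x\<bar> powr (p - 1) * h x \<partial>M) / N s powr (p - 1)" for s
        by (simp add: G_def)
      ultimately have "(\<lambda>m. G (t m)) \<longlonglongrightarrow> G 0" by (simp only:)
      then show ?thesis by (intro tendsto_intros)
    qed
    ultimately show ?thesis by (intro tendsto_lowerbound) auto
  qed
  have "G 0 = y" using half[of 1] half[of "-1"] by simp
  then show ?thesis by (simp add: G_def N_def v0)
qed

text \<open>For \<open>p > 1\<close> attainment at \<open>u k\<close> makes the norming function of
  \<open>u k\<close> represent all the values at once; for \<open>p = 1\<close> the density comes
  from \<open>L1_functional_density\<close>.\<close>

proposition supporting_functional_density:
  fixes u :: "'i \<Rightarrow> 'b \<Rightarrow> real"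
  assumes p: "1 \<le> p" and J: "finite J" and u: "\<And>j. j \<in> J \<Longrightarrow> u j \<in> Lspace M (ereal p)"
    and le: "\<And>c. (\<Sum>j\<in>J. c j * y j) \<le> Lnorm M (ereal p) (\<lambda>x. \<Sum>j\<in>J. c j * u j x)"
    and k: "k \<in> J" "y k = Lnorm M (ereal p) (u k)" "y k > 0"
  obtains g where "g \<in> Lball M (conj_exp p)" "\<And>j. j \<in> J \<Longrightarrow> (\<integral>x. g x * u j x \<partial>M) = y j"
proof (cases "p = 1")
  case True
  have "\<exists>g\<in>borel_measurable M. (\<forall>x. \<bar>g x\<bar> \<le> 1) \<and> (\<forall>j\<in>J. (\<integral>x. g x * u j x \<partial>M) = y j)"
    by (rule L1_functional_density[OF J])
      (use u le True in \<open>simp_all add: Lspace_one_iff Lnorm_one flip: one_ereal_def\<close>)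
  then show thesis using that True by (auto simp: conj_exp_1 Lball_infinity_iff)
next
  case False
  then have p1: "p > 1" using p by simp
  let ?g = "\<lambda>x. sgn (u k x) * \<bar>u k x\<bar> powr (p - 1) / Lnorm M (ereal p) (u k) powr (p - 1)"
  have "(\<integral>x. ?g x * u j x \<partial>M) = y j" if j: "j \<in> J" for j
  proof (rule Lp_supporting_functional[OF p1 u[OF k(1)] u[OF j]])
    fix t :: real
    \<comment> \<open>The coefficient vector is a sum of two indicators so that the identity also
      holds for \<open>j = k\<close>.\<close>
    have s: "(\<Sum>i\<in>J. ((if i = k then 1 else 0) + (if i = j then t else 0)) * q i) = q k + t * q j" for q
      using J k j by (simp add: distrib_right sum.distrib if_distrib[of "\<lambda>a. a * _"] sum.delta cong: if_cong)
    show "Lnorm M (ereal p) (u k) + t * y j \<le> Lnorm M (ereal p) (\<lambda>x. u k x + t * u j x)"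
      using le[of "\<lambda>i. (if i = k then 1 else 0) + (if i = j then t else 0)"] k by (simp add: s)
  qed (use k in simp)
  then show thesis
    using norming_function_in_Lball(1)[OF p1 u[OF k(1)]] k by (intro that[of ?g]) auto
qed

section \<open>Best simultaneous approximation\<close>

lemma SUP_attained_compact:
  fixes \<phi> :: "'a::topological_space \<Rightarrow> real"
  assumes "compact A" "A \<noteq> {}" "continuous_on A \<phi>"
  shows "\<exists>a\<in>A. \<phi> a = (SUP a\<in>A. \<phi> a)" and "\<And>a. a \<in> A \<Longrightarrow> \<phi> a \<le> (SUP a\<in>A. \<phi> a)"
proof -
  obtain a where a: "a \<in> A" "\<And>b. b \<in> A \<Longrightarrow> \<phi> b \<le> \<phi> a"
    using continuous_attains_sup[OF assms] by blast
  then have "(SUP b\<in>A. \<phi> b) = \<phi> a" by (intro cSup_eq_maximum) auto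
  then show "\<exists>a\<in>A. \<phi> a = (SUP a\<in>A. \<phi> a)" "\<And>b. b \<in> A \<Longrightarrow> \<phi> b \<le> (SUP a\<in>A. \<phi> a)"
    using a by auto
qed

text \<open>The norm is Lipschitz in \<open>f a\<close> with constant \<open>\<bar>s\<bar>\<close>.
  The factor \<open>s\<close> is carried along because functionals are later constrained on all
  multiples of a residual.\<close>

lemma continuous_on_Lnorm_affine:
  fixes f :: "'a::topological_space \<Rightarrow> 'b \<Rightarrow> real"
  assumes p: "1 \<le> p" and f: "\<And>a. a \<in> A \<Longrightarrow> f a \<in> Lspace M (ereal p)"
    and lim: "\<And>a0. a0 \<in> A \<Longrightarrow>
      ((\<lambda>a. Lnorm M (ereal p) (\<lambda>x. f a x - f a0 x)) \<longlongrightarrow> 0) (at a0 within A)"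
    and w: "w \<in> Lspace M (ereal p)"
  shows "continuous_on A (\<lambda>a. Lnorm M (ereal p) (\<lambda>x. s * f a x + w x))"
  unfolding continuous_on_def
proof
  fix a0 assume a0: "a0 \<in> A"
  let ?\<phi> = "\<lambda>a. Lnorm M (ereal p) (\<lambda>x. s * f a x + w x)"
  have v: "(\<lambda>x. s * f a x + w x) \<in> Lspace M (ereal p)" if "a \<in> A" for a
    by (rule Lspace_add[OF p Lspace_scale[OF f[OF that]] w])
  have "\<bar>?\<phi> a - ?\<phi> a0\<bar> \<le> \<bar>s\<bar> * Lnorm M (ereal p) (\<lambda>x. f a x - f a0 x)" if "a \<in> A" for a
    using Lnorm_diff_le[OF p v[OF that] v[OF a0]] Lnorm_scale[OF p, of M s "\<lambda>x. f a x - f a0 x"]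
    by (simp add: right_diff_distrib)
  then have "\<forall>\<^sub>F a in at a0 within A. norm (?\<phi> a - ?\<phi> a0) \<le> \<bar>s\<bar> * Lnorm M (ereal p) (\<lambda>x. f a x - f a0 x)"
    by (auto simp: eventually_at_topological)
  moreover have "((\<lambda>a. \<bar>s\<bar> * Lnorm M (ereal p) (\<lambda>x. f a x - f a0 x)) \<longlongrightarrow> 0) (at a0 within A)"
    using tendsto_mult_left[OF lim[OF a0], of "\<bar>s\<bar>"] by simp
  ultimately have "((\<lambda>a. ?\<phi> a - ?\<phi> a0) \<longlongrightarrow> 0) (at a0 within A)"
    by (rule Lim_null_comparison)
  then show "(?\<phi> \<longlongrightarrow> ?\<phi> a0) (at a0 within A)" by (simp add: LIM_zero_iff)
qed

lemma sum_fun_apply: "(\<Sum>v\<in>B. F v) x = (\<Sum>v\<in>B. F v x)" for F :: "'i \<Rightarrow> 'b \<Rightarrow> 'c::comm_monoid_add"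
  by (induction B rule: infinite_finite_induct) auto

lemma fscale_subspace_coordinates:
  fixes H :: "('b \<Rightarrow> real) set"
  assumes sub: "module.subspace fscale H" and dim: "vector_space.dim fscale H = n" and n: "1 \<le> n"
  obtains h where "\<And>j. j < n \<Longrightarrow> h j \<in> H" "\<And>c. (\<lambda>x. \<Sum>j<n. c j * h j x) \<in> H"
    "\<And>w. w \<in> H \<Longrightarrow> \<exists>c. w = (\<lambda>x. \<Sum>j<n. c j * h j x)"
proof -
  interpret V: vector_space fscale by (rule vector_space_fscale)
  obtain B where B: "B \<subseteq> H" "V.independent B" "H \<subseteq> V.span B" "card B = V.dim H"
    using V.basis_exists .
  \<comment> \<open>A positive cardinality rules out an infinite basis, whose \<open>card\<close>
    would be 0.\<close>
  have finB: "finite B" using B(4) dim n by (intro card_ge_0_finite) simp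
  obtain b where b: "bij_betw b {..<n} B"
    using ex_bij_betw_nat_finite[OF finB] B(4) dim by (auto simp: atLeast0LessThan)
  have sumb: "(\<Sum>v\<in>B. fscale (q v) v) = (\<lambda>x. \<Sum>j<n. q (b j) * b j x)" for q
  proof
    fix x
    have "(\<Sum>v\<in>B. fscale (q v) v) x = (\<Sum>v\<in>B. q v * v x)"
      by (simp add: sum_fun_apply fscale_def)
    also have "\<dots> = (\<Sum>j<n. q (b j) * b j x)"
      using sum.reindex_bij_betw[OF b, of "\<lambda>v. q v * v x"] by simp
    finally show "(\<Sum>v\<in>B. fscale (q v) v) x = (\<Sum>j<n. q (b j) * b j x)" .
  qed
  show thesis
  proof (rule that)
    show bH: "b j \<in> H" if "j < n" for j using b B(1) that by (auto simp: bij_betw_def)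
    show "(\<lambda>x. \<Sum>j<n. c j * b j x) \<in> H" for c
    proof -
      have "(\<Sum>j<n. fscale (c j) (b j)) \<in> H"
        using bH sub by (intro V.subspace_sum V.subspace_scale) auto
      also have "(\<Sum>j<n. fscale (c j) (b j)) = (\<lambda>x. \<Sum>j<n. c j * b j x)"
        by (simp add: fun_eq_iff sum_fun_apply fscale_def)
      finally show ?thesis .
    qed
    show "\<exists>c. w = (\<lambda>x. \<Sum>j<n. c j * b j x)" if "w \<in> H" for w
    proof -
      have "w \<in> V.span B" using that B(3) by auto
      then obtain q where "w = (\<Sum>v\<in>B. fscale (q v) v)" using V.span_finite[OF finB] by auto
      then show ?thesis using sumb[of q] by auto
    qed
  qed
qed

text \<open>A functional on \<open>span {r a, h 0, \<dots>, h (n - 1)}\<close> is recorded by its values \<open>y j\<close> on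
  \<open>h j\<close> for \<open>j < n\<close> and \<open>y n\<close> on \<open>r a\<close>.\<close>

proposition optimal_imp_supporting_functionals:
  fixes r :: "'a::t2_space \<Rightarrow> 'b \<Rightarrow> real" and h :: "nat \<Rightarrow> 'b \<Rightarrow> real"
  assumes p: "1 \<le> p" and A: "compact A"
    and r: "\<And>a. a \<in> A \<Longrightarrow> r a \<in> Lspace M (ereal p)"
    and h: "\<And>j. j < n \<Longrightarrow> h j \<in> Lspace M (ereal p)"
    and cont: "\<And>s w. w \<in> Lspace M (ereal p) \<Longrightarrow>
      continuous_on A (\<lambda>a. Lnorm M (ereal p) (\<lambda>x. s * r a x + w x))"
    and E0: "0 \<le> E" and E: "\<And>a. a \<in> A \<Longrightarrow> Lnorm M (ereal p) (r a) \<le> E"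
    and opt: "\<And>c. \<exists>a\<in>A. E \<le> Lnorm M (ereal p) (\<lambda>x. r a x + (\<Sum>j<n. c j * h j x))"
  shows "\<exists>l Y as. (\<Sum>i\<le>n. l i) = 1 \<and> (\<forall>j<n. (\<Sum>i\<le>n. l i * Y i j) = 0) \<and>
    (\<forall>i\<le>n. 0 \<le> l i \<and> as i \<in> A \<and> Y i n = E \<and>
      (\<forall>c s. s * Y i n + (\<Sum>j<n. c j * Y i j) \<le>
        Lnorm M (ereal p) (\<lambda>x. s * r (as i) x + (\<Sum>j<n. c j * h j x))))"
proof -
  define Hc where "Hc c x = (\<Sum>j<n. c j * h j x)" for c x
  have Hc: "Hc c \<in> Lspace M (ereal p)" for c
    unfolding Hc_def using h by (intro Lspace_sum[OF p]) auto
  \<comment> \<open>A functional of norm at most one is bounded by these numbers on the generators;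
    coordinates beyond \<open>n\<close> are frozen at zero so that the box is compact.\<close>
  define B where "B j = (if j < n then Lnorm M (ereal p) (h j) else if j = n then E else 0)" for j
  have B0: "0 \<le> B j" for j using E0 by (simp add: B_def Lnorm_nonneg)
  define T where "T = A \<times> PiE UNIV (\<lambda>j. {- B j..B j})"
  have cT: "compact T" unfolding T_def by (intro compact_Times A compact_PiE_UNIV compact_Icc)
  have coord: "continuous_on S (\<lambda>z. snd z j)" for S :: "('a \<times> (nat \<Rightarrow> real)) set" and j
    by (rule continuous_on_product_then_coordinatewise[OF continuous_on_snd[OF continuous_on_id]])
  have pairing: "continuous_on S (\<lambda>z. \<Sum>j<n. c j * snd z j)"
    for S :: "('a \<times> (nat \<Rightarrow> real)) set" and c
    by (intro continuous_on_sum continuous_on_mult continuous_on_const coord)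
  \<comment> \<open>The pairs of a parameter \<open>a\<close> and a functional of norm at most one
    on the span belonging to \<open>a\<close>. Each constraint is closed jointly in both components
    because the norm is continuous in \<open>a\<close>.\<close>
  define X where "X = T \<inter> (\<Inter>(c, s). {z \<in> T. s * snd z n + (\<Sum>j<n. c j * snd z j) \<le>
    Lnorm M (ereal p) (\<lambda>x. s * r (fst z) x + Hc c x)})"
  have "closed {z \<in> T. s * snd z n + (\<Sum>j<n. c j * snd z j) \<le>
    Lnorm M (ereal p) (\<lambda>x. s * r (fst z) x + Hc c x)}" for c s
  proof (rule continuous_on_closed_Collect_le)
    show "continuous_on T (\<lambda>z. s * snd z n + (\<Sum>j<n. c j * snd z j))"
      by (intro continuous_on_add continuous_on_mult continuous_on_const coord pairing)
    show "continuous_on T (\<lambda>z. Lnorm M (ereal p) (\<lambda>x. s * r (fst z) x + Hc c x))"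
      by (rule continuous_on_compose2[OF cont[OF Hc] continuous_on_fst[OF continuous_on_id]])
        (auto simp: T_def)
    show "closed T" using cT by (rule compact_imp_closed)
  qed
  then have cX: "compact X" unfolding X_def
    by (intro compact_Int_closed[OF cT] closed_INT) auto
  have X_iff: "(a, y) \<in> X \<longleftrightarrow> a \<in> A \<and> (\<forall>j. \<bar>y j\<bar> \<le> B j) \<and>
    (\<forall>c s. s * y n + (\<Sum>j<n. c j * y j) \<le> Lnorm M (ereal p) (\<lambda>x. s * r a x + Hc c x))" for a y
    by (auto simp: X_def T_def PiE_iff abs_le_iff minus_le_iff)
  \<comment> \<open>The values of a norming function on the generators form such a functional, so
    \<open>X\<close> suffices to compute the norms of all perturbed residuals.\<close>
  have norming: "\<exists>y. (a, y) \<in> X \<and> y n + (\<Sum>j<n. c j * y j) = Lnorm M (ereal p) (\<lambda>x. r a x + Hc c x)"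
    if a: "a \<in> A" for a c
  proof -
    obtain g where g: "g \<in> Lball M (conj_exp p)"
      "(\<integral>x. g x * (r a x + Hc c x) \<partial>M) = Lnorm M (ereal p) (\<lambda>x. r a x + Hc c x)"
      using Lnorm_attained[OF p Lspace_add[OF p r[OF a] Hc]] .
    define y where "y j = (if j < n then \<integral>x. g x * h j x \<partial>M else if j = n then \<integral>x. g x * r a x \<partial>M else 0)" for j
    have int: "(\<integral>x. g x * (s * r a x + Hc d x) \<partial>M) = s * y n + (\<Sum>j<n. d j * y j)" for d s
    proof -
      have "(\<integral>x. g x * (s * r a x + Hc d x) \<partial>M) = (\<integral>x. s * (g x * r a x) + g x * Hc d x \<partial>M)"
        by (simp add: algebra_simps)
      also have "\<dots> = s * (\<integral>x. g x * r a x \<partial>M) + (\<integral>x. g x * Hc d x \<partial>M)"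
        using Hoelder_Lball(1)[OF p r[OF a] g(1)] Hoelder_Lball(1)[OF p Hc g(1)] by simp
      also have "(\<integral>x. g x * Hc d x \<partial>M) = (\<Sum>j<n. d j * y j)"
        unfolding Hc_def using h by (subst integral_Lball_sum[OF p _ g(1)]) (auto simp: y_def)
      finally show ?thesis by (simp add: y_def)
    qed
    have "s * y n + (\<Sum>j<n. d j * y j) \<le> Lnorm M (ereal p) (\<lambda>x. s * r a x + Hc d x)" for d s
      unfolding int[symmetric]
      by (rule Hoelder_Lball(2)[OF p Lspace_add[OF p Lspace_scale[OF r[OF a]] Hc] g(1)])
    moreover have "\<bar>y j\<bar> \<le> B j" for j
      using abs_integral_Lball_le[OF p h g(1), of j]
        order_trans[OF abs_integral_Lball_le[OF p r[OF a] g(1)] E[OF a]]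
      by (auto simp: y_def B_def)
    moreover have "y n + (\<Sum>j<n. c j * y j) = Lnorm M (ereal p) (\<lambda>x. r a x + Hc c x)"
      using g(2) int[of 1 c] by simp
    ultimately show ?thesis using a by (auto simp: X_iff)
  qed
  have yE: "snd z n \<le> E" if "z \<in> X" for z
    using that X_iff[of "fst z" "snd z"] by (auto simp: B_def dest!: spec[of _ n])
  define K where "K = snd ` (X \<inter> {z. snd z n = E})"
  have "closed {z :: 'a \<times> (nat \<Rightarrow> real). snd z n = E}"
    by (intro closed_Collect_eq continuous_on_const coord)
  then have cK: "compact K" unfolding K_def
    by (intro compact_continuous_image continuous_on_snd continuous_on_id compact_Int_closed cX)
  \<comment> \<open>By the alternative it is enough to exclude a separating direction
    \<open>c\<close>: a small step along \<open>- c\<close> would lower the error at every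
    parameter.\<close>
  have "\<not> (\<forall>y\<in>K. 0 < (\<Sum>j<n. c j * y j))" for c
  proof
    assume pos: "\<forall>y\<in>K. 0 < (\<Sum>j<n. c j * y j)"
    \<comment> \<open>The functionals whose value does not drop along the step. None of them has the
      value \<open>E\<close> on its residual, so by compactness they stay below \<open>E\<close> by
      a uniform gap \<open>\<eta>\<close>.\<close>
    define X' where "X' = X \<inter> {z. (\<Sum>j<n. c j * snd z j) \<le> 0}"
    have cX': "compact X'" unfolding X'_def
      by (intro compact_Int_closed[OF cX] closed_Collect_le pairing continuous_on_const)
    have "\<exists>\<eta>>0. \<forall>z\<in>X'. snd z n \<le> E - \<eta>"
    proof (cases "X' = {}")
      case True
      then show ?thesis by (auto intro: exI[of _ 1])
    next
      case False
      then obtain z1 where z1: "z1 \<in> X'" "\<And>z. z \<in> X' \<Longrightarrow> snd z n \<le> snd z1 n"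
        using continuous_attains_sup[OF cX' _ coord] by blast
      have "snd z1 n \<noteq> E"
      proof
        assume "snd z1 n = E"
        then have "snd z1 \<in> K" using z1(1) by (auto simp: K_def X'_def)
        then show False using pos z1(1) by (fastforce simp: X'_def)
      qed
      then have "snd z1 n < E" using yE[of z1] z1(1) by (auto simp: X'_def)
      then show ?thesis using z1(2) by (intro exI[of _ "E - snd z1 n"]) auto
    qed
    then obtain \<eta> where \<eta>: "\<eta> > 0" "\<And>z. z \<in> X' \<Longrightarrow> snd z n \<le> E - \<eta>" by blast
    \<comment> \<open>Bounds the change of every functional per unit step; the added 1 keeps it
      positive. With \<open>t * L = \<eta> / 2\<close> the functionals in \<open>X'\<close> cannot
      make up the gap.\<close>
    define L where "L = (\<Sum>j<n. \<bar>c j\<bar> * B j) + 1"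
    have L0: "L > 0" unfolding L_def using B0 by (intro add_nonneg_pos sum_nonneg) auto
    define t where "t = \<eta> / (2 * L)"
    have t: "t > 0" "t * L = \<eta> / 2" using \<eta> L0 by (auto simp: t_def)
    obtain a where a: "a \<in> A" "E \<le> Lnorm M (ereal p) (\<lambda>x. r a x + Hc (\<lambda>j. - t * c j) x)"
      using opt[of "\<lambda>j. - t * c j"] by (auto simp: Hc_def)
    obtain y where y: "(a, y) \<in> X"
      "y n + (\<Sum>j<n. - t * c j * y j) = Lnorm M (ereal p) (\<lambda>x. r a x + Hc (\<lambda>j. - t * c j) x)"
      using norming[OF a(1), of "\<lambda>j. - t * c j"] by auto
    define D where "D = (\<Sum>j<n. c j * y j)"
    have "(\<Sum>j<n. - t * c j * y j) = - t * D" by (simp add: D_def sum_distrib_left sum_negf mult.assoc)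
    then have Ey: "E \<le> y n - t * D" using y(2) a(2) by simp
    show False
    proof (cases "D > 0")
      case True
      then have "t * D > 0" using t by simp
      then show False using Ey yE[OF y(1)] by simp
    next
      case False
      then have "y n \<le> E - \<eta>" using \<eta>(2)[of "(a, y)"] y(1) by (simp add: X'_def D_def)
      moreover have "- D \<le> L"
      proof -
        have "\<bar>D\<bar> \<le> (\<Sum>j<n. \<bar>c j * y j\<bar>)" unfolding D_def by (rule sum_abs)
        also have "\<dots> \<le> (\<Sum>j<n. \<bar>c j\<bar> * B j)"
          using y(1) by (intro sum_mono) (auto simp: abs_mult X_iff intro!: mult_left_mono)
        finally show ?thesis unfolding L_def by linarith
      qed
      then have "t * (- D) \<le> t * L" using t by (intro mult_left_mono) auto
      ultimately show False using Ey t(2) \<eta>(1) by simp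
    qed
  qed
  then obtain l Y where lY: "\<forall>i\<le>n. 0 \<le> l i \<and> Y i \<in> K" "(\<Sum>i\<le>n. l i) = (1::real)"
    "\<forall>j<n. (\<Sum>i\<le>n. l i * Y i j) = 0"
    using gordan_caratheodory[OF cK, of n] by blast
  have "\<forall>i\<in>{..n}. \<exists>a. (a, Y i) \<in> X \<and> Y i n = E"
    using lY(1) by (force simp: K_def)
  then obtain as where as: "\<forall>i\<in>{..n}. (as i, Y i) \<in> X \<and> Y i n = E"
    using bchoice[of "{..n}"] by meson
  have "0 \<le> l i \<and> as i \<in> A \<and> Y i n = E \<and> (\<forall>c s. s * Y i n + (\<Sum>j<n. c j * Y i j) \<le>
    Lnorm M (ereal p) (\<lambda>x. s * r (as i) x + (\<Sum>j<n. c j * h j x)))" if "i \<le> n" for i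
    using lY(1) as that unfolding X_iff Hc_def by blast
  then show ?thesis using lY(2,3) by blast
qed

lemma integral_Lball_combination:
  assumes p: "1 \<le> p" and g: "\<And>i. i \<in> I \<Longrightarrow> g i \<in> Lball M (conj_exp p)" and u: "u \<in> Lspace M (ereal p)"
  shows "(\<integral>x. (\<Sum>i\<in>I. l i * g i x) * u x \<partial>M) = (\<Sum>i\<in>I. l i * (\<integral>x. g i x * u x \<partial>M))"
proof -
  have "(\<integral>x. (\<Sum>i\<in>I. l i * (g i x * u x)) \<partial>M) = (\<Sum>i\<in>I. (\<integral>x. l i * (g i x * u x) \<partial>M))"
    using Hoelder_Lball(1)[OF p u g] by (intro Bochner_Integration.integral_sum) auto
  then show ?thesis by (simp add: sum_distrib_right mult.assoc)
qed

theorem theorem5: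
  fixes M :: "'b measure" and p :: real
    and A :: "'a::t2_space set" and f :: "'a \<Rightarrow> 'b \<Rightarrow> real"
    and H :: "('b \<Rightarrow> real) set" and n :: nat and fstar :: "'b \<Rightarrow> real"
  assumes "sigma_finite_measure M"
    and "1 \<le> p"
    and "compact A" and "A \<noteq> {}"
    and "\<forall>a\<in>A. f a \<in> Lspace M (ereal p)"
    and "\<forall>a0\<in>A. ((\<lambda>a. Lnorm M (ereal p) (\<lambda>x. f a x - f a0 x)) \<longlongrightarrow> 0) (at a0 within A)"
    and "H \<subseteq> Lspace M (ereal p)"
    and "module.subspace fscale H"
    and "vector_space.dim fscale H = n" and "1 \<le> n"
    and "fstar \<in> H"
  shows "(\<forall>h\<in>H. (SUP a\<in>A. Lnorm M (ereal p) (\<lambda>x. f a x - fstar x))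
                 \<le> (SUP a\<in>A. Lnorm M (ereal p) (\<lambda>x. f a x - h x)))
     \<longleftrightarrow>
     (\<exists>k::nat. \<exists>as :: nat \<Rightarrow> 'a. \<exists>g :: nat \<Rightarrow> 'b \<Rightarrow> real. \<exists>lam :: nat \<Rightarrow> real.
        1 \<le> k \<and> k \<le> n + 1 \<and>
        (\<forall>i\<in>{1..k}. as i \<in> A \<and> g i \<in> Lball M (conj_exp p) \<and> lam i > 0) \<and>
        (\<Sum>i=1..k. lam i) = 1 \<and>
        (\<forall>h\<in>H. (\<integral>x. (\<Sum>i=1..k. lam i * g i x) * h x \<partial>M) = 0) \<and>
        (\<forall>i\<in>{1..k}.
           (\<integral>x. g i x * (f (as i) x - fstar x) \<partial>M) = Lnorm M (ereal p) (\<lambda>x. f (as i) x - fstar x) \<and>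
           Lnorm M (ereal p) (\<lambda>x. f (as i) x - fstar x)
             = (SUP a\<in>A. Lnorm M (ereal p) (\<lambda>x. f a x - fstar x))))"
    (is "?optimal \<longleftrightarrow> ?certificate")
proof -
  note p = assms(2) and A = assms(3,4)
  have fL: "f a \<in> Lspace M (ereal p)" if "a \<in> A" for a using assms(5) that by blast
  have HL: "w \<in> Lspace M (ereal p)" if "w \<in> H" for w using assms(7) that by blast
  obtain b where b: "\<And>j. j < n \<Longrightarrow> b j \<in> H" "\<And>c. (\<lambda>x. \<Sum>j<n. c j * b j x) \<in> H"
    "\<And>w. w \<in> H \<Longrightarrow> \<exists>c. w = (\<lambda>x. \<Sum>j<n. c j * b j x)"
    using fscale_subspace_coordinates[OF assms(8,9,10)] by blast
  have Hdiff: "(\<lambda>x. v x - w x) \<in> H" if vw: "v \<in> H" "w \<in> H" for v w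
  proof -
    obtain c d where "v = (\<lambda>x. \<Sum>j<n. c j * b j x)" "w = (\<lambda>x. \<Sum>j<n. d j * b j x)"
      using b(3) vw by meson
    then show ?thesis using b(2)[of "\<lambda>j. c j - d j"] by (simp add: left_diff_distrib sum_subtractf)
  qed
  have cont: "continuous_on A (\<lambda>a. Lnorm M (ereal p) (\<lambda>x. s * f a x + w x))"
    if "w \<in> Lspace M (ereal p)" for s w
    using continuous_on_Lnorm_affine[OF p fL assms(6)[rule_format] that] .
  have contd: "continuous_on A (\<lambda>a. Lnorm M (ereal p) (\<lambda>x. f a x - w x))" if "w \<in> H" for w
    using cont[OF Lspace_scale[OF HL[OF that]], of 1 "-1"] by simp
  define E where "E w = (SUP a\<in>A. Lnorm M (ereal p) (\<lambda>x. f a x - w x))" for w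
  have E_le: "Lnorm M (ereal p) (\<lambda>x. f a x - w x) \<le> E w" if "a \<in> A" "w \<in> H" for a w
    unfolding E_def using SUP_attained_compact(2)[OF A contd[OF that(2)] that(1)] .
  have E_att: "\<exists>a\<in>A. Lnorm M (ereal p) (\<lambda>x. f a x - w x) = E w" if "w \<in> H" for w
    unfolding E_def using SUP_attained_compact(1)[OF A contd[OF that]] .
  obtain a0 where a0: "a0 \<in> A" "Lnorm M (ereal p) (\<lambda>x. f a0 x - fstar x) = E fstar"
    using E_att[OF assms(11)] by blast
  have E0: "0 \<le> E fstar" using a0(2) Lnorm_nonneg[of M p] by metis
  define r where "r a x = f a x - fstar x" for a x
  have rL: "r a \<in> Lspace M (ereal p)" if "a \<in> A" for a
    unfolding r_def by (rule Lspace_diff[OF p fL[OF that] HL[OF assms(11)]])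

  \<comment> \<open>From optimality to a certificate\<close>
  have forward: "?certificate" if opt: "\<forall>w\<in>H. E fstar \<le> E w"
  proof (cases "E fstar = 0")
    \<comment> \<open>With zero error the zero function at one maximising parameter is already a
      certificate.\<close>
    case True
    show ?thesis
      using a0 True zero_in_Lball[OF p]
      by (intro exI[of _ 1] exI[of _ "\<lambda>_. a0"] exI[of _ "\<lambda>_ _. 0"] exI[of _ "\<lambda>_. 1"])
        (simp add: E_def)
  next
    case False
    then have Epos: "0 < E fstar" using E0 by simp
    have "\<exists>l Y as. (\<Sum>i\<le>n. l i) = 1 \<and> (\<forall>j<n. (\<Sum>i\<le>n. l i * Y i j) = 0) \<and>
      (\<forall>i\<le>n. 0 \<le> l i \<and> as i \<in> A \<and> Y i n = E fstar \<and>
        (\<forall>c s. s * Y i n + (\<Sum>j<n. c j * Y i j) \<le>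
          Lnorm M (ereal p) (\<lambda>x. s * r (as i) x + (\<Sum>j<n. c j * b j x))))"
    proof (rule optimal_imp_supporting_functionals[OF p A(1) rL HL[OF b(1)] _ E0])
      show "continuous_on A (\<lambda>a. Lnorm M (ereal p) (\<lambda>x. s * r a x + w x))"
        if "w \<in> Lspace M (ereal p)" for s w
      proof -
        have "(\<lambda>x. w x - s * fstar x) \<in> Lspace M (ereal p)"
          by (rule Lspace_diff[OF p that Lspace_scale[OF HL[OF assms(11)]]])
        from cont[OF this, of s] show ?thesis by (simp add: r_def algebra_simps)
      qed
      show "Lnorm M (ereal p) (r a) \<le> E fstar" if "a \<in> A" for a
        using E_le[OF that assms(11)] by (simp add: r_def[abs_def])
      show "\<exists>a\<in>A. E fstar \<le> Lnorm M (ereal p) (\<lambda>x. r a x + (\<Sum>j<n. c j * b j x))" for c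
      proof -
        have w: "(\<lambda>x. fstar x - (\<Sum>j<n. c j * b j x)) \<in> H" by (rule Hdiff[OF assms(11) b(2)])
        from E_att[OF w] opt w show ?thesis by (auto simp: r_def algebra_simps intro!: bexI)
      qed
    qed
    then obtain l Y as where lY: "(\<Sum>i\<le>n. l i) = 1" "\<forall>j<n. (\<Sum>i\<le>n. l i * Y i j) = 0"
      and lY': "\<forall>i\<le>n. 0 \<le> l i \<and> as i \<in> A \<and> Y i n = E fstar \<and>
        (\<forall>c s. s * Y i n + (\<Sum>j<n. c j * Y i j) \<le>
          Lnorm M (ereal p) (\<lambda>x. s * r (as i) x + (\<Sum>j<n. c j * b j x)))"
      by (elim exE conjE)
    have l0: "0 \<le> l i" and as: "as i \<in> A" and YE: "Y i n = E fstar" if "i \<le> n" for i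
      using lY'[rule_format, OF that] by simp_all
    have Y: "s * Y i n + (\<Sum>j<n. c j * Y i j) \<le>
        Lnorm M (ereal p) (\<lambda>x. s * r (as i) x + (\<Sum>j<n. c j * b j x))"
      if "i \<le> n" for i c s using lY'[rule_format, OF that] by blast
    \<comment> \<open>The functional itself gives the lower bound, through \<open>s = 1\<close> and
      zero coefficients.\<close>
    have rE: "Lnorm M (ereal p) (r (as i)) = E fstar" if "i \<le> n" for i
      using Y[OF that, of 1 "\<lambda>_. 0"] YE[OF that] E_le[OF as[OF that] assms(11)]
      by (simp add: r_def[abs_def])
    have "\<exists>g. g \<in> Lball M (conj_exp p) \<and> (\<forall>j<n. (\<integral>x. g x * b j x \<partial>M) = Y i j) \<and>
      (\<integral>x. g x * r (as i) x \<partial>M) = E fstar" if i: "i \<le> n" for i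
    proof -
      \<comment> \<open>The residual sits at index \<open>n\<close>, in agreement with the
        convention for \<open>Y i n\<close>.\<close>
      define u where "u j = (if j < n then b j else r (as i))" for j
      have split: "(\<Sum>j\<le>n. q j) = q n + (\<Sum>j<n. q j)" for q :: "nat \<Rightarrow> real"
        by (simp add: lessThan_Suc_atMost[symmetric])
      obtain g where g: "g \<in> Lball M (conj_exp p)" "\<And>j. j \<in> {..n} \<Longrightarrow> (\<integral>x. g x * u j x \<partial>M) = Y i j"
      proof (rule supporting_functional_density[OF p, of "{..n}" u M "Y i" n])
        show "u j \<in> Lspace M (ereal p)" if "j \<in> {..n}" for j
          using HL[OF b(1)] rL[OF as[OF i]] by (simp add: u_def)
        show "(\<Sum>j\<le>n. c j * Y i j) \<le> Lnorm M (ereal p) (\<lambda>x. \<Sum>j\<le>n. c j * u j x)" for c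
          using Y[OF i, of "c n" c] by (simp add: split u_def)
      qed (use rE[OF i] YE[OF i] Epos in \<open>auto simp: u_def\<close>)
      have "\<forall>j<n. (\<integral>x. g x * b j x \<partial>M) = Y i j"
      proof (intro allI impI)
        fix j assume "j < n"
        then show "(\<integral>x. g x * b j x \<partial>M) = Y i j" using g(2)[of j] by (simp add: u_def)
      qed
      moreover have "(\<integral>x. g x * r (as i) x \<partial>M) = E fstar" using g(2)[of n] YE[OF i] by (simp add: u_def)
      ultimately show ?thesis using g(1) by blast
    qed
    then obtain G where G: "\<And>i. i \<le> n \<Longrightarrow> G i \<in> Lball M (conj_exp p)"
      "\<And>i j. i \<le> n \<Longrightarrow> j < n \<Longrightarrow> (\<integral>x. G i x * b j x \<partial>M) = Y i j"
      "\<And>i. i \<le> n \<Longrightarrow> (\<integral>x. G i x * r (as i) x \<partial>M) = E fstar" by metis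
    \<comment> \<open>Vanishing weights are discarded to make the remaining ones positive;
      \<open>e\<close> then renumbers the indices from 1 to \<open>k\<close>.\<close>
    define I where "I = {i. i \<le> n \<and> l i > 0}"
    have I: "finite I" "I \<subseteq> {..n}" by (auto simp: I_def)
    have sumI: "(\<Sum>i\<in>I. l i * q i) = (\<Sum>i\<le>n. l i * q i)" for q
      using l0 I by (intro sum.mono_neutral_left) (auto simp: I_def order_less_le)
    have I1: "(\<Sum>i\<in>I. l i) = 1" using sumI[of "\<lambda>_. 1"] lY(1) by simp
    define k where "k = card I"
    have "k \<le> card {..n}" unfolding k_def using I by (intro card_mono) auto
    then have kn: "k \<le> n + 1" by simp
    have "I \<noteq> {}" using I1 by auto
    then have k1: "1 \<le> k" using I(1) by (simp add: k_def Suc_le_eq card_gt_0_iff)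
    obtain e where e: "bij_betw e {1..k} I"
      using ex_bij_betw_nat_finite_1[OF I(1)] unfolding k_def by blast
    have eI: "e i \<le> n \<and> l (e i) > 0" if "i \<in> {1..k}" for i
      using bij_betwE[OF e] that by (auto simp: I_def)
    have sume: "(\<Sum>i=1..k. q (e i)) = (\<Sum>i\<in>I. q i)" for q :: "nat \<Rightarrow> real"
      by (rule sum.reindex_bij_betw[OF e])
    have orth: "(\<integral>x. (\<Sum>i=1..k. l (e i) * G (e i) x) * w x \<partial>M) = 0" if w: "w \<in> H" for w
    proof -
      obtain c where c: "w = (\<lambda>x. \<Sum>j<n. c j * b j x)" using b(3)[OF w] by blast
      have Gw: "(\<integral>x. G i x * w x \<partial>M) = (\<Sum>j<n. c j * Y i j)" if i: "i \<le> n" for i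
        unfolding c using HL[OF b(1)] G(1,2)[OF i] by (subst integral_Lball_sum[OF p]) auto
      have "(\<integral>x. (\<Sum>i=1..k. l (e i) * G (e i) x) * w x \<partial>M) =
        (\<Sum>i=1..k. l (e i) * (\<integral>x. G (e i) x * w x \<partial>M))"
        using G(1) eI by (intro integral_Lball_combination[OF p _ HL[OF w]]) auto
      also have "\<dots> = (\<Sum>i\<le>n. l i * (\<integral>x. G i x * w x \<partial>M))"
        using sume[of "\<lambda>i. l i * (\<integral>x. G i x * w x \<partial>M)"] sumI by simp
      also have "\<dots> = (\<Sum>i\<le>n. \<Sum>j<n. c j * (l i * Y i j))"
        by (simp add: Gw sum_distrib_left mult.left_commute)
      also have "\<dots> = (\<Sum>j<n. c j * (\<Sum>i\<le>n. l i * Y i j))"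
        by (subst sum.swap) (simp add: sum_distrib_left)
      finally show ?thesis using lY(2) by simp
    qed
    have attain: "(\<integral>x. G (e i) x * (f (as (e i)) x - fstar x) \<partial>M) = E fstar"
      "Lnorm M (ereal p) (\<lambda>x. f (as (e i)) x - fstar x) = E fstar" if "i \<in> {1..k}" for i
      using G(3)[of "e i"] rE[of "e i"] eI[OF that] by (simp_all add: r_def[abs_def])
    show ?thesis
      using k1 kn orth attain eI as G(1) sume[of l] I1
      by (intro exI[of _ k] exI[of _ "\<lambda>i. as (e i)"] exI[of _ "\<lambda>i. G (e i)"] exI[of _ "\<lambda>i. l (e i)"])
        (simp add: E_def)
  qed

  \<comment> \<open>From a certificate to optimality\<close>
  have backward: "E fstar \<le> E w" if w: "w \<in> H" and "?certificate" for w
  proof -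
    obtain k as g lam where "1 \<le> k" "k \<le> n + 1"
      "\<forall>i\<in>{1..k}. as i \<in> A \<and> g i \<in> Lball M (conj_exp p) \<and> lam i > 0" "(\<Sum>i=1..k. lam i) = 1"
      "\<forall>h\<in>H. (\<integral>x. (\<Sum>i=1..k. lam i * g i x) * h x \<partial>M) = 0"
      "\<forall>i\<in>{1..k}.
         (\<integral>x. g i x * (f (as i) x - fstar x) \<partial>M) = Lnorm M (ereal p) (\<lambda>x. f (as i) x - fstar x) \<and>
         Lnorm M (ereal p) (\<lambda>x. f (as i) x - fstar x) = E fstar"
      using \<open>?certificate\<close>[folded E_def] by (elim exE conjE)
    then have C: "\<And>i. i \<in> {1..k} \<Longrightarrow> as i \<in> A \<and> g i \<in> Lball M (conj_exp p) \<and> lam i > 0"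
      "(\<Sum>i=1..k. lam i) = 1"
      "\<And>h. h \<in> H \<Longrightarrow> (\<integral>x. (\<Sum>i=1..k. lam i * g i x) * h x \<partial>M) = 0"
      "\<And>i. i \<in> {1..k} \<Longrightarrow> (\<integral>x. g i x * (f (as i) x - fstar x) \<partial>M) = E fstar"
      by simp_all
    define v where "v x = fstar x - w x" for x
    have v: "v \<in> H" unfolding v_def by (rule Hdiff[OF assms(11) w])
    \<comment> \<open>Orthogonality allows \<open>v\<close> to be added under the integrals, so
      \<open>E fstar\<close> becomes a weighted mean of pairings with the residuals of
      \<open>w\<close>, each at most \<open>E w\<close>.\<close>
    have "0 = (\<Sum>i=1..k. lam i * (\<integral>x. g i x * v x \<partial>M))"
      using C(3)[OF v] integral_Lball_combination[OF p _ HL[OF v], of "{1..k}" g lam] C(1) by auto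
    moreover have "E fstar = (\<Sum>i=1..k. lam i * E fstar)"
      using C(2) by (simp flip: sum_distrib_right)
    ultimately have "E fstar = (\<Sum>i=1..k. lam i * (E fstar + (\<integral>x. g i x * v x \<partial>M)))"
      by (simp add: distrib_left sum.distrib)
    also have "\<dots> \<le> (\<Sum>i=1..k. lam i * E w)"
    proof (rule sum_mono)
      fix i assume i: "i \<in> {1..k}"
      note g = C(1)[OF i, THEN conjunct2, THEN conjunct1]
      have a: "as i \<in> A" using C(1)[OF i] by blast
      have "E fstar + (\<integral>x. g i x * v x \<partial>M) = (\<integral>x. g i x * r (as i) x + g i x * v x \<partial>M)"
        using Hoelder_Lball(1)[OF p rL[OF a] g] Hoelder_Lball(1)[OF p HL[OF v] g] C(4)[OF i]
        by (simp add: r_def[abs_def])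
      also have "\<dots> = (\<integral>x. g i x * (f (as i) x - w x) \<partial>M)"
        by (simp add: r_def v_def algebra_simps)
      also have "\<dots> \<le> E w"
        using Hoelder_Lball(2)[OF p Lspace_diff[OF p fL[OF a] HL[OF w]] g] E_le[OF a w] by linarith
      finally show "lam i * (E fstar + (\<integral>x. g i x * v x \<partial>M)) \<le> lam i * E w"
        using C(1)[OF i] by (intro mult_left_mono) auto
    qed
    also have "\<dots> = E w" using C(2) by (simp flip: sum_distrib_right)
    finally show ?thesis .
  qed
  show ?thesis
  proof
    assume ?optimal
    then show ?certificate by (intro forward) (simp add: E_def)
  next
    assume ?certificate
    then show ?optimal using backward unfolding E_def by blast
  qed
qed

end
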